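(* There exists a finitely generated simple group $G$ which has infinite commutator width and for which there is a finite generating set $X$ of $G$ with $pw(G,X)<\infty$.
   Context: Let $G$ be a group with generating set $X$, and write $X^{\pm 1} = X \cup X^{-1}$. Let $F_X$ be the free group on $X$ and $\pi: F_X \to G$ the natural map. An element of $F_X$ is called a palindrome if it can be written as $y_1 y_2 \cdots y_k$ with each $y_j \in X^{\pm 1}$ (regarded as letters of $F_X$) and $y_j = y_{k-j+1}$ for all $1 \le j \le k$. An element of $G$ is called a palindrome (with respect to $X$) if at least one of its preimages under $\pi$ is a palindrome in $F_X$. Let $P_{G,X}$ be the set of all palindromes of $G$ with respect to $X$. The palindromic width of $G$ with respect to $X$ is $$pw(G,X)=\sup_{g \in G} \min\Big\{ k \;\Big|\; g = \prod_{i=1}^k p_i,\ p_i \in P_{G,X}\Big\},$$ which may be infinite. The commutator width of $G$ is the supremum, over all $g$ in the commutator subgroup $[G,G]$, of the minimal number of commutators whose product is $g$; it is infinite if this supremum is infinite. *)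

theory Defs
  imports "HOL-Algebra.Generated_Groups" "HOL-Library.Extended_Nat"
begin

(* The library locale simple_group assumes "order G > 1", where order is the cardinality
   of the carrier; it is 0 for infinite carriers, so that locale only covers finite groups. *)
definition simple_grp :: "('a, 'b) monoid_scheme \<Rightarrow> bool" where
  "simple_grp G \<longleftrightarrow>
     group G \<and> carrier G \<noteq> {\<one>\<^bsub>G\<^esub>} \<and> (\<forall>N. N \<lhd> G \<longrightarrow> N = {\<one>\<^bsub>G\<^esub>} \<or> N = carrier G)"

definition generating_set :: "('a, 'b) monoid_scheme \<Rightarrow> 'a set \<Rightarrow> bool" where
  "generating_set G X \<longleftrightarrow> X \<subseteq> carrier G \<and> generate G X = carrier G"

definition finitely_generated :: "('a, 'b) monoid_scheme \<Rightarrow> bool" where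
  "finitely_generated G \<longleftrightarrow> (\<exists>X. finite X \<and> generating_set G X)"

definition list_prod :: "('a, 'b) monoid_scheme \<Rightarrow> 'a list \<Rightarrow> 'a" where
  "list_prod G xs = foldr (\<otimes>\<^bsub>G\<^esub>) xs \<one>\<^bsub>G\<^esub>"

(* The minimum, with value \<infinity> if g is not a product of elements of S. *)
definition length_wrt :: "('a, 'b) monoid_scheme \<Rightarrow> 'a set \<Rightarrow> 'a \<Rightarrow> enat" where
  "length_wrt G S g =
     (INF k \<in> {k. \<exists>ps. length ps = k \<and> set ps \<subseteq> S \<and> list_prod G ps = g}. enat k)"

definition commutator_width :: "('a, 'b) monoid_scheme \<Rightarrow> enat" where
  "commutator_width G =
     (SUP g \<in> derived G (carrier G). length_wrt G (derived_set G (carrier G)) g)"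


text \<open>A letter (x, True) stands for x and (x, False) for its formal inverse. The free group
  consists of the words in these letters modulo insertion and deletion of adjacent
  mutually inverse letters.\<close>

type_synonym 'a word = "('a \<times> bool) list"

definition words :: "'a set \<Rightarrow> 'a word set" where
  "words X = lists (X \<times> UNIV)"

definition cancel :: "'a set \<Rightarrow> ('a word \<times> 'a word) set" where
  "cancel X = {(u @ [(x, b), (x, \<not> b)] @ v, u @ v) | u v x b.
                 u \<in> words X \<and> v \<in> words X \<and> x \<in> X}"

definition free_eq :: "'a set \<Rightarrow> ('a word \<times> 'a word) set" where
  "free_eq X = {(u, v). u \<in> words X \<and> v \<in> words X \<and> (u, v) \<in> (cancel X \<union> (cancel X)\<inverse>)\<^sup>*}"

definition free_group :: "'a set \<Rightarrow> 'a word set monoid" where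
  "free_group X =
     \<lparr> carrier = words X // free_eq X,
       mult = (\<lambda>A B. \<Union>a\<in>A. \<Union>b\<in>B. free_eq X `` {a @ b}),
       one = free_eq X `` {[]} \<rparr>"

definition free_gen :: "'a set \<Rightarrow> 'a \<Rightarrow> 'a word set" where
  "free_gen X x = free_eq X `` {[(x, True)]}"

definition word_val :: "('a, 'b) monoid_scheme \<Rightarrow> 'a word \<Rightarrow> 'a" where
  "word_val G w = list_prod G (map (\<lambda>(x, b). if b then x else inv\<^bsub>G\<^esub> x) w)"

(* The common value in G of the words representing a given element of the free group. *)
definition natural_map :: "('a, 'b) monoid_scheme \<Rightarrow> 'a word set \<Rightarrow> 'a" where
  "natural_map G A = the_elem (word_val G ` A)"


definition free_letters :: "'a set \<Rightarrow> 'a word set set" where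
  "free_letters X = free_gen X ` X \<union> (\<lambda>x. inv\<^bsub>free_group X\<^esub> free_gen X x) ` X"

definition free_palindromes :: "'a set \<Rightarrow> 'a word set set" where
  "free_palindromes X =
     {list_prod (free_group X) ys | ys. set ys \<subseteq> free_letters X \<and> rev ys = ys}"

definition palindromes :: "('a, 'b) monoid_scheme \<Rightarrow> 'a set \<Rightarrow> 'a set" where
  "palindromes G X =
     {g \<in> carrier G. \<exists>f \<in> carrier (free_group X). natural_map G f = g \<and> f \<in> free_palindromes X}"

definition palindromic_width :: "('a, 'b) monoid_scheme \<Rightarrow> 'a set \<Rightarrow> enat" where
  "palindromic_width G X = (SUP g \<in> carrier G. length_wrt G (palindromes G X) g)"


lemma words_Nil [simp]: "[] \<in> words X"
  by (simp add: words_def)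

lemma words_append [simp]: "u @ v \<in> words X \<longleftrightarrow> u \<in> words X \<and> v \<in> words X"
  by (auto simp: words_def)

lemma words_Cons [simp]: "a # v \<in> words X \<longleftrightarrow> fst a \<in> X \<and> v \<in> words X"
  by (cases a) (auto simp: words_def)

lemma equiv_free_eq: "equiv (words X) (free_eq X)"
proof (rule equivI)
  show "free_eq X \<subseteq> words X \<times> words X" by (auto simp: free_eq_def)
  show "refl_on (words X) (free_eq X)" by (auto simp: refl_on_def free_eq_def)
  have "sym ((cancel X \<union> (cancel X)\<inverse>)\<^sup>*)" by (intro sym_rtrancl sym_Un_converse)
  then show "sym (free_eq X)" by (auto simp: sym_def free_eq_def)
  show "trans (free_eq X)" by (auto simp: trans_def free_eq_def)
qed

lemma cancelE:
  assumes "(u, v) \<in> cancel X"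
  obtains s t x b where "u = s @ [(x, b), (x, \<not> b)] @ t" "v = s @ t"
    "s \<in> words X" "t \<in> words X" "x \<in> X"
  using assms unfolding cancel_def by blast

lemma cancel_append:
  assumes "(u, v) \<in> cancel X" "p \<in> words X" "q \<in> words X"
  shows "(p @ u @ q, p @ v @ q) \<in> cancel X"
proof -
  obtain s t x b where *: "u = s @ [(x, b), (x, \<not> b)] @ t" "v = s @ t"
    "s \<in> words X" "t \<in> words X" "x \<in> X"
    using assms(1) by (rule cancelE)
  have "p @ u @ q = (p @ s) @ [(x, b), (x, \<not> b)] @ (t @ q)" "p @ v @ q = (p @ s) @ (t @ q)"
    using * by simp_all
  moreover have "p @ s \<in> words X" "t @ q \<in> words X" using * assms by simp_all
  ultimately show ?thesis using *(5) unfolding cancel_def by blast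
qed

lemma free_eq_append:
  assumes "(u, u') \<in> free_eq X" "(v, v') \<in> free_eq X"
  shows "(u @ v, u' @ v') \<in> free_eq X"
proof -
  let ?R = "cancel X \<union> (cancel X)\<inverse>"
  have ctx: "(p @ a @ q, p @ b @ q) \<in> ?R\<^sup>*"
    if "(a, b) \<in> ?R\<^sup>*" "p \<in> words X" "q \<in> words X" for a b p q
    using that(1)
  proof (induction rule: rtrancl_induct)
    case base
    then show ?case by simp
  next
    case (step y z)
    then have "(p @ y @ q, p @ z @ q) \<in> ?R" using cancel_append that(2,3) by blast
    with step.IH show ?case by (rule rtrancl_into_rtrancl)
  qed
  have w: "u \<in> words X" "u' \<in> words X" "v \<in> words X" "v' \<in> words X"
    and r: "(u, u') \<in> ?R\<^sup>*" "(v, v') \<in> ?R\<^sup>*"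
    using assms by (auto simp: free_eq_def)
  have "(u @ v, u' @ v) \<in> ?R\<^sup>*" using ctx[OF r(1), of "[]" v] w by simp
  moreover have "(u' @ v, u' @ v') \<in> ?R\<^sup>*" using ctx[OF r(2), of u' "[]"] w by simp
  ultimately show ?thesis using w by (auto simp: free_eq_def)
qed

lemma free_group_mult:
  assumes "u \<in> words X" "v \<in> words X"
  shows "free_eq X `` {u} \<otimes>\<^bsub>free_group X\<^esub> free_eq X `` {v} = free_eq X `` {u @ v}"
proof -
  have "congruent2 (free_eq X) (free_eq X) (\<lambda>a b. free_eq X `` {a @ b})"
    using free_eq_append
    by (intro congruent2I' equiv_class_eq[OF equiv_free_eq])
  then show ?thesis
    unfolding free_group_def
    using UN_equiv_class2[OF equiv_free_eq equiv_free_eq _ assms] by simp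
qed

lemma free_eq_inverse:
  assumes "u \<in> words X"
  shows "\<exists>v\<in>words X. (v @ u, []) \<in> free_eq X"
  using assms
proof (induction u)
  case Nil
  then show ?case by (intro bexI[of _ "[]"]) (auto simp: free_eq_def)
next
  case (Cons a u)
  obtain x b where a: "a = (x, b)" by fastforce
  with Cons obtain v where v: "v \<in> words X" "(v @ u, []) \<in> free_eq X" by auto
  have "(v @ [(x, \<not> b), (x, \<not> \<not> b)] @ u, v @ u) \<in> cancel X"
    unfolding cancel_def mem_Collect_eq
    using Cons.prems v(1) a
    by (intro exI[of _ v] exI[of _ u] exI[of _ x] exI[of _ "\<not> b"]) simp
  then have "(v @ [(x, \<not> b)] @ a # u, v @ u) \<in> (cancel X \<union> (cancel X)\<inverse>)\<^sup>*"
    using a by (intro r_into_rtrancl) simp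
  then have "(v @ [(x, \<not> b)] @ a # u, v @ u) \<in> free_eq X"
    using Cons.prems v(1) a by (simp add: free_eq_def)
  then have "((v @ [(x, \<not> b)]) @ a # u, []) \<in> free_eq X"
    using transD[OF _ _ v(2)] equiv_free_eq[of X] by (simp add: equiv_def)
  then show ?case using Cons.prems v(1) a by (intro bexI[of _ "v @ [(x, \<not> b)]"]) auto
qed

lemma free_group_class:
  assumes "A \<in> carrier (free_group X)"
  obtains u where "u \<in> words X" "A = free_eq X `` {u}"
  using assms by (auto simp: free_group_def elim: quotientE)

lemma free_group_class_closed [intro]:
  "u \<in> words X \<Longrightarrow> free_eq X `` {u} \<in> carrier (free_group X)"
  by (auto simp: free_group_def intro: quotientI)

lemma free_group_one: "\<one>\<^bsub>free_group X\<^esub> = free_eq X `` {[]}"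
  by (simp add: free_group_def)

lemma group_free_group: "group (free_group X)"
proof (rule groupI)
  show "\<one>\<^bsub>free_group X\<^esub> \<in> carrier (free_group X)"
    by (auto simp: free_group_one)
next
  fix A B assume "A \<in> carrier (free_group X)" "B \<in> carrier (free_group X)"
  then show "A \<otimes>\<^bsub>free_group X\<^esub> B \<in> carrier (free_group X)"
    by (elim free_group_class) (auto simp: free_group_mult)
next
  fix A B C
  assume "A \<in> carrier (free_group X)" "B \<in> carrier (free_group X)" "C \<in> carrier (free_group X)"
  then show "A \<otimes>\<^bsub>free_group X\<^esub> B \<otimes>\<^bsub>free_group X\<^esub> C = A \<otimes>\<^bsub>free_group X\<^esub> (B \<otimes>\<^bsub>free_group X\<^esub> C)"
    by (elim free_group_class) (simp add: free_group_mult)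
next
  fix A assume "A \<in> carrier (free_group X)"
  then show "\<one>\<^bsub>free_group X\<^esub> \<otimes>\<^bsub>free_group X\<^esub> A = A"
    by (elim free_group_class) (simp add: free_group_mult free_group_one)
next
  fix A assume "A \<in> carrier (free_group X)"
  then obtain u where u: "u \<in> words X" "A = free_eq X `` {u}" by (rule free_group_class)
  obtain v where v: "v \<in> words X" "(v @ u, []) \<in> free_eq X" using free_eq_inverse[OF u(1)] by blast
  have "free_eq X `` {v} \<otimes>\<^bsub>free_group X\<^esub> A = \<one>\<^bsub>free_group X\<^esub>"
    using u v equiv_class_eq[OF equiv_free_eq v(2)] by (simp add: free_group_mult free_group_one)
  then show "\<exists>B\<in>carrier (free_group X). B \<otimes>\<^bsub>free_group X\<^esub> A = \<one>\<^bsub>free_group X\<^esub>"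
    using v(1) by blast
qed

context group
begin

lemma word_val_Nil [simp]: "word_val G [] = \<one>"
  by (simp add: word_val_def list_prod_def)

lemma word_val_Cons [simp]:
  "word_val G ((x, b) # w) = (if b then x else inv x) \<otimes> word_val G w"
  by (simp add: word_val_def list_prod_def)

lemma word_val_closed [simp]:
  assumes "X \<subseteq> carrier G" "w \<in> words X"
  shows "word_val G w \<in> carrier G"
  using assms(2)
proof (induction w)
  case (Cons a w)
  then show ?case using assms(1) by (cases a) auto
qed simp

lemma word_val_append:
  assumes "X \<subseteq> carrier G" "u \<in> words X" "v \<in> words X"
  shows "word_val G (u @ v) = word_val G u \<otimes> word_val G v"
  using assms(2)
proof (induction u)
  case Nil
  then show ?case using word_val_closed[OF assms(1,3)] by simp
next
  case (Cons a u)
  then have "fst a \<in> carrier G" "word_val G u \<in> carrier G"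
    using assms(1) word_val_closed[OF assms(1)] by auto
  then show ?case
    using Cons word_val_closed[OF assms(1,3)] by (cases a) (auto simp: m_assoc)
qed

lemma word_val_free_eq:
  assumes "X \<subseteq> carrier G" "(u, v) \<in> free_eq X"
  shows "word_val G u = word_val G v"
proof -
  have *: "word_val G a = word_val G b" if ab: "(a, b) \<in> cancel X" for a b
  proof -
    obtain s t x c where st: "a = s @ [(x, c), (x, \<not> c)] @ t" "b = s @ t"
      "s \<in> words X" "t \<in> words X" "x \<in> X"
      using ab by (rule cancelE)
    have x: "x \<in> carrier G" and t: "word_val G t \<in> carrier G"
      using st assms(1) word_val_closed[OF assms(1)] by auto
    then have "word_val G ([(x, c), (x, \<not> c)] @ t) = word_val G t"
      by (simp add: m_assoc[symmetric])
    then show ?thesis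
      using st word_val_append[OF assms(1), of s "[(x, c), (x, \<not> c)] @ t"]
        word_val_append[OF assms(1), of s t] by simp
  qed
  have "(u, v) \<in> (cancel X \<union> (cancel X)\<inverse>)\<^sup>*" using assms(2) by (simp add: free_eq_def)
  then show ?thesis
  proof (induction rule: rtrancl_induct)
    case (step y z)
    from step.hyps(2) have "word_val G y = word_val G z" using *[of y z] *[of z y] by auto
    with step.IH show ?case by simp
  qed simp
qed

lemma natural_map_class:
  assumes "X \<subseteq> carrier G" "u \<in> words X"
  shows "natural_map G (free_eq X `` {u}) = word_val G u"
proof -
  have "u \<in> free_eq X `` {u}" using assms(2) by (simp add: free_eq_def)
  moreover have "word_val G v = word_val G u" if "v \<in> free_eq X `` {u}" for v
    using that word_val_free_eq[OF assms(1), of u v] by simp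
  ultimately have "word_val G ` (free_eq X `` {u}) = {word_val G u}" by blast
  then show ?thesis by (simp add: natural_map_def)
qed

lemma natural_map_hom:
  assumes "X \<subseteq> carrier G"
  shows "natural_map G \<in> hom (free_group X) G"
proof (rule homI)
  fix A assume "A \<in> carrier (free_group X)"
  then show "natural_map G A \<in> carrier G"
    using assms by (elim free_group_class) (auto simp: natural_map_class)
next
  fix A B assume "A \<in> carrier (free_group X)" "B \<in> carrier (free_group X)"
  then show "natural_map G (A \<otimes>\<^bsub>free_group X\<^esub> B) = natural_map G A \<otimes> natural_map G B"
    using assms
    by (elim free_group_class) (simp add: free_group_mult natural_map_class word_val_append)
qed

lemma natural_map_free_gen:
  assumes "X \<subseteq> carrier G" "x \<in> X"
  shows "natural_map G (free_gen X x) = x"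
  using assms by (auto simp: free_gen_def natural_map_class)

end

end

theory Submission
  imports Defs "HOL-Algebra.Sym_Groups" "HOL-Library.Countable_Set"
begin

text \<open>Let \<open>L\<close> be a finite perfect group with an element \<open>z\<close> that is not conjugate to its inverse; the
  7-cycle in the alternating group of degree 7 is an example. Label the edges at every vertex of the
  \<open>|L|\<close>-regular tree by \<open>L\<close>. The group in question, an instance of Le Boudec's groups with almost
  prescribed local action, consists of the tree automorphisms generated by two copies of
  \<open>L \<times> L\<close>, one for each end of a base edge, that permute the edges at this vertex by
  \<open>x \<mapsto> g x h\<^sup>-\<^sup>1\<close> and act elsewhere by left translations of the labels.

  Simplicity: a nontrivial normal subgroup contains an element moving some half-tree off itself, hence
  all commutators of elements supported in this half-tree. As \<open>L\<close> is perfect, it contains the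
  stabilisers \<open>{(g, g)}\<close> of the base edge and then, by perfectness again, both copies of \<open>L \<times> L\<close>.

  Infinite commutator width: the action preserves the conjugacy class of the turn \<open>x\<^sup>-\<^sup>1y\<close> between two
  edges at a vertex. Hence the number of turns conjugate to \<open>z\<close> minus the number of turns conjugate to
  \<open>z\<^sup>-\<^sup>1\<close> on the path from the base edge to its image is an unbounded quasimorphism.

  Finite palindromic width: in a simple group, for a generating set not admitting an anti-automorphism
  that fixes each generator, every element is a palindrome (Fink and Thom).\<close>

subsection \<open>Palindromes in simple groups\<close>

lemma words_rev [simp]: "rev w \<in> words X \<longleftrightarrow> w \<in> words X"
  by (auto simp: words_def in_lists_conv_set)

lemma words_mono: "X \<subseteq> Y \<Longrightarrow> w \<in> words X \<Longrightarrow> w \<in> words Y"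
  by (auto simp: words_def)

text \<open>Inverts every letter but keeps the order, so the formal inverse of \<open>w\<close> is
  \<open>rev (flip_word w)\<close>.\<close>

definition flip_word :: "'a word \<Rightarrow> 'a word" where
  "flip_word w = map (\<lambda>(x, b). (x, \<not> b)) w"

lemma flip_word_simps [simp]:
  "flip_word [] = []" "flip_word ((x, b) # w) = (x, \<not> b) # flip_word w"
  by (simp_all add: flip_word_def)

lemma rev_flip_word: "rev (flip_word w) = flip_word (rev w)"
  by (simp add: flip_word_def rev_map)

lemma flip_word_in_words [simp]: "flip_word w \<in> words X \<longleftrightarrow> w \<in> words X"
  by (induction w) auto

context group
begin

lemma word_val_rev_flip:
  assumes X: "X \<subseteq> carrier G" and w: "w \<in> words X"
  shows "word_val G (rev (flip_word w)) = inv (word_val G w)"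
  using w
proof (induction w)
  case Nil
  then show ?case by simp
next
  case (Cons a w)
  obtain x b where a: "a = (x, b)" by fastforce
  have x: "x \<in> carrier G" "x \<in> X" and w: "w \<in> words X" using Cons.prems X a by auto
  then have wc: "word_val G w \<in> carrier G" using X by simp
  have "word_val G (rev (flip_word (a # w))) = word_val G (rev (flip_word w) @ [(x, \<not> b)])"
    by (simp add: a)
  also have "\<dots> = word_val G (rev (flip_word w)) \<otimes> word_val G [(x, \<not> b)]"
    by (rule word_val_append[OF X]) (use x w in auto)
  also have "\<dots> = inv (word_val G w) \<otimes> (if b then inv x else x)"
    using Cons.IH w x by simp
  also have "\<dots> = inv (word_val G (a # w))"
    using x wc by (simp add: a inv_mult_group)
  finally show ?case .
qed

lemma generate_eq_word_val:
  assumes X: "X \<subseteq> carrier G"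
  shows "generate G X = word_val G ` words X"
proof
  show "generate G X \<subseteq> word_val G ` words X"
  proof
    fix g assume "g \<in> generate G X"
    then show "g \<in> word_val G ` words X"
    proof induction
      case one
      show ?case by (rule image_eqI[of _ _ "[]"]) auto
    next
      case (incl h)
      then show ?case using X by (intro image_eqI[of _ _ "[(h, True)]"]) auto
    next
      case (inv h)
      then show ?case using X by (intro image_eqI[of _ _ "[(h, False)]"]) auto
    next
      case (eng g h)
      then obtain u v where "u \<in> words X" "v \<in> words X" "g = word_val G u" "h = word_val G v"
        by blast
      then show ?case using word_val_append[OF X] by (intro image_eqI[of _ _ "u @ v"]) auto
    qed
  qed
  show "word_val G ` words X \<subseteq> generate G X"
  proof
    fix g assume "g \<in> word_val G ` words X"
    then obtain w where w: "w \<in> words X" "g = word_val G w" by blast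
    from w(1) have "word_val G w \<in> generate G X"
    proof (induction w)
      case Nil
      show ?case using generate.one[of G X] by simp
    next
      case (Cons a w)
      obtain x b where a: "a = (x, b)" by fastforce
      then show ?case using Cons
        by (auto intro: generate.eng generate.incl generate.inv)
    qed
    then show "g \<in> generate G X" using w by simp
  qed
qed

lemma countable_generate:
  assumes "X \<subseteq> carrier G" "countable X"
  shows "countable (generate G X)"
proof -
  have "countable (words X)" using assms(2) by (auto simp: words_def)
  then show ?thesis using generate_eq_word_val[OF assms(1)] by simp
qed

text \<open>Passes letter by letter from classes in the free group to concrete words, so that
  palindromes can be produced as words equal to their reversal.\<close>

lemma word_val_palindrome:
  assumes X: "X \<subseteq> carrier G" and w: "w \<in> words X" "rev w = w"
  shows "word_val G w \<in> palindromes G X"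
proof -
  interpret F: group "free_group X" by (rule group_free_group)
  define letter where "letter = (\<lambda>(x, b). if b then free_gen X x else inv\<^bsub>free_group X\<^esub> free_gen X x)"
  have letter: "letter (x, b) = free_eq X `` {[(x, b)]}" if "x \<in> X" for x b
  proof -
    have *: "[(x, c)] \<in> words X" for c using that by simp
    have "([(x, False), (x, True)], []) \<in> cancel X"
      unfolding cancel_def mem_Collect_eq
      by (rule exI[of _ "[]"], rule exI[of _ "[]"], rule exI[of _ x], rule exI[of _ False])
         (use that in simp)
    then have "([(x, False), (x, True)], []) \<in> free_eq X"
      using that by (auto simp: free_eq_def)
    then have "free_eq X `` {[(x, False), (x, True)]} = \<one>\<^bsub>free_group X\<^esub>"
      using equiv_class_eq[OF equiv_free_eq] by (simp add: free_group_one)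
    then have "free_eq X `` {[(x, False)]} \<otimes>\<^bsub>free_group X\<^esub> free_gen X x = \<one>\<^bsub>free_group X\<^esub>"
      unfolding free_gen_def using free_group_mult[OF * *, of False True] by simp
    then have "inv\<^bsub>free_group X\<^esub> free_gen X x = free_eq X `` {[(x, False)]}"
      using * by (intro F.inv_equality) (auto simp: free_gen_def)
    then show ?thesis by (auto simp: letter_def free_gen_def)
  qed
  have prod: "list_prod (free_group X) (map letter u) = free_eq X `` {u}" if "u \<in> words X" for u
    using that
  proof (induction u)
    case Nil
    then show ?case by (simp add: list_prod_def free_group_one)
  next
    case (Cons a u)
    obtain x b where a: "a = (x, b)" by fastforce
    have "x \<in> X" "u \<in> words X" using Cons.prems a by auto
    moreover from this have "list_prod (free_group X) (map letter (a # u)) =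
        free_eq X `` {[(x, b)]} \<otimes>\<^bsub>free_group X\<^esub> free_eq X `` {u}"
      using Cons.IH letter[of x b] by (simp add: a list_prod_def)
    moreover have "[(x, b)] \<in> words X" using \<open>x \<in> X\<close> by simp
    ultimately show ?case using free_group_mult[of "[(x, b)]" X u] a by simp
  qed
  have "set (map letter w) \<subseteq> free_letters X"
    using w(1) by (fastforce simp: words_def letter_def free_letters_def in_lists_conv_set)
  moreover have "rev (map letter w) = map letter w" using w(2) by (simp add: rev_map)
  ultimately have "free_eq X `` {w} \<in> free_palindromes X"
    unfolding free_palindromes_def mem_Collect_eq
    using prod[OF w(1)] by (intro exI[of _ "map letter w"]) simp
  moreover have "free_eq X `` {w} \<in> carrier (free_group X)" using w(1) by blast
  ultimately show ?thesis
    unfolding palindromes_def using natural_map_class[OF X w(1)] X w(1) by auto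
qed

text \<open>Reversal is an anti-automorphism of the free group, so it sends the normal subgroup of
  relators to a normal subgroup, whose image in \<open>G\<close> is normal because words exhaust
  \<open>G\<close>.\<close>

lemma reversed_relators_normal:
  assumes X: "generating_set G X"
  shows "{word_val G (rev w) |w. w \<in> words X \<and> word_val G w = \<one>} \<lhd> G" (is "?N \<lhd> G")
proof -
  have XG: "X \<subseteq> carrier G" and gen: "carrier G = word_val G ` words X"
    using X generate_eq_word_val by (auto simp: generating_set_def)
  note val = word_val_append[OF XG] word_val_closed[OF XG] word_val_rev_flip[OF XG]
  have "subgroup ?N G"
  proof (rule subgroupI)
    show "?N \<subseteq> carrier G" using XG by auto
    have "\<one> = word_val G (rev [])" by simp
    then show "?N \<noteq> {}" by (auto intro: exI[of _ "[]"])
  next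
    fix a assume "a \<in> ?N"
    then obtain w where w: "w \<in> words X" "word_val G w = \<one>" "a = word_val G (rev w)" by blast
    have "inv a = word_val G (rev (flip_word (rev w)))"
      using val(3)[of "rev w"] w by simp
    moreover have "word_val G (flip_word (rev w)) = \<one>"
      using val(3)[of w] w by (simp add: rev_flip_word)
    ultimately show "inv a \<in> ?N" using w by (intro CollectI exI[of _ "flip_word (rev w)"]) auto
  next
    fix a b assume "a \<in> ?N" "b \<in> ?N"
    then obtain u v where "u \<in> words X" "word_val G u = \<one>" "a = word_val G (rev u)"
      "v \<in> words X" "word_val G v = \<one>" "b = word_val G (rev v)" by blast
    then show "a \<otimes> b \<in> ?N"
      by (intro CollectI exI[of _ "v @ u"]) (auto simp: val)
  qed
  then show ?thesis
    unfolding normal_inv_iff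
  proof (intro conjI ballI)
    fix g a assume "g \<in> carrier G" "a \<in> ?N"
    then obtain u w where u: "u \<in> words X" "g = word_val G u"
      and w: "w \<in> words X" "word_val G w = \<one>" "a = word_val G (rev w)"
      using gen by blast
    \<comment> \<open>The reversal of the witness is
      \<open>u @ rev w @ rev (flip_word u)\<close>.\<close>
    have "g \<otimes> a \<otimes> inv g = word_val G (rev (flip_word u @ w @ rev u))"
      using u w by (simp add: val m_assoc)
    moreover have "word_val G (flip_word u @ w @ rev u) = \<one>"
    proof -
      have "word_val G (flip_word u) = inv (word_val G (rev u))"
        using val(3)[of "rev u"] u by (simp add: rev_flip_word)
      then show ?thesis using u w by (simp add: val)
    qed
    ultimately show "g \<otimes> a \<otimes> inv g \<in> ?N"
      using u w by (intro CollectI exI[of _ "flip_word u @ w @ rev u"]) auto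
  qed
qed

end

text \<open>If a word \<open>w\<close> represents the identity, then \<open>rev w @ w\<close> is a palindrome representing
  the same element as \<open>rev w\<close>. So it suffices that the elements \<open>rev w\<close> exhaust the group; they form
  a normal subgroup, which is made nontrivial by adding one generator.\<close>

lemma simple_grp_palindromic_width:
  fixes G (structure)
  assumes "simple_grp G" "finitely_generated G"
    and nonab: "x \<in> carrier G" "y \<in> carrier G" "x \<otimes>\<^bsub>G\<^esub> y \<noteq> y \<otimes>\<^bsub>G\<^esub> x"
  shows "\<exists>S. finite S \<and> generating_set G S \<and> palindromic_width G S < \<infinity>"
proof -
  interpret group G using assms(1) by (simp add: simple_grp_def)
  obtain X where X: "finite X" "generating_set G X"
    using assms(2) by (auto simp: finitely_generated_def)
  have XG: "X \<subseteq> carrier G" and gen: "carrier G = word_val G ` words X"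
    using X generate_eq_word_val by (auto simp: generating_set_def)
  \<comment> \<open>Otherwise reversing words would not change their values, and reversing a product
    would make \<open>G\<close> abelian.\<close>
  have "\<exists>w\<in>words X. word_val G (rev w) \<noteq> word_val G w"
  proof (rule ccontr)
    assume "\<not> ?thesis"
    then have *: "word_val G (rev w) = word_val G w" if "w \<in> words X" for w
      using that by blast
    obtain u v where uv: "u \<in> words X" "v \<in> words X" "x = word_val G u" "y = word_val G v"
      using nonab gen by blast
    have "x \<otimes> y = word_val G (rev (u @ v))"
      using uv *[of "u @ v"] word_val_append[OF XG] by simp
    also have "\<dots> = y \<otimes> x"
      using uv *[of u] *[of v] word_val_append[OF XG, of "rev v" "rev u"] by simp
    finally show False using nonab by simp
  qed
  then obtain w where w: "w \<in> words X" "word_val G (rev w) \<noteq> word_val G w" by blast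
  \<comment> \<open>As a generator, \<open>g\<close> is a single letter and its own reversal,
    whereas reversing \<open>w\<close> changes its value. So the relator formed by \<open>w\<close>
    and the inverse letter of \<open>g\<close> has a reversal with nontrivial value.\<close>
  define g where "g = word_val G w"
  have g: "g \<in> carrier G" using w XG by (simp add: g_def)
  define S where "S = insert g X"
  have SG: "S \<subseteq> carrier G" using XG g by (simp add: S_def)
  have "carrier G = generate G X" using X by (simp add: generating_set_def)
  also have "\<dots> \<subseteq> generate G S" by (rule mono_generate) (auto simp: S_def)
  finally have S: "generating_set G S"
    unfolding generating_set_def using SG generate_incl[OF SG] by auto
  define N where "N = {word_val G (rev w) |w. w \<in> words S \<and> word_val G w = \<one>}"
  have "N \<lhd> G" unfolding N_def by (rule reversed_relators_normal[OF S])
  have wS: "w \<in> words S" using w(1) words_mono[of X S] by (auto simp: S_def)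
  have wr: "word_val G (rev w) \<in> carrier G" using wS SG by simp
  have "word_val G (w @ [(g, False)]) = \<one>"
    using word_val_append[OF SG wS, of "[(g, False)]"] g by (simp add: S_def g_def[symmetric])
  then have "word_val G (rev (w @ [(g, False)])) \<in> N"
    unfolding N_def using wS by (intro CollectI exI[of _ "w @ [(g, False)]"]) (auto simp: S_def)
  then have "inv g \<otimes> word_val G (rev w) \<in> N" by simp
  moreover have "inv g \<otimes> word_val G (rev w) \<noteq> \<one>"
    using w(2) g wr unfolding g_def[symmetric] by (metis inv_closed inv_inv inv_equality)
  ultimately have "N = carrier G"
    using \<open>N \<lhd> G\<close> assms(1) by (auto simp: simple_grp_def)
  have "length_wrt G (palindromes G S) h \<le> 1" if "h \<in> carrier G" for h
  proof -
    have "h \<in> N" using that \<open>N = carrier G\<close> by simp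
    then obtain v where v: "v \<in> words S" "word_val G v = \<one>" "h = word_val G (rev v)"
      unfolding N_def by blast
    have h: "h = word_val G (rev v @ v)"
      using v SG word_val_append[OF SG, of "rev v" v] by simp
    have "h \<in> palindromes G S"
      unfolding h by (rule word_val_palindrome[OF SG]) (use v in auto)
    then have "\<exists>ps. length ps = 1 \<and> set ps \<subseteq> palindromes G S \<and> list_prod G ps = h"
      using that by (intro exI[of _ "[h]"]) (simp add: list_prod_def)
    then show ?thesis
      unfolding length_wrt_def using INF_lower[of 1 _ enat] by (simp add: one_enat_def)
  qed
  then have "palindromic_width G S \<le> 1"
    unfolding palindromic_width_def by (rule SUP_least)
  then have "palindromic_width G S < \<infinity>"
    by (rule le_less_trans) (simp add: one_enat_def)
  then show ?thesis using S X by (auto simp: S_def)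
qed

subsection \<open>Commutator width and isomorphic copies\<close>

text \<open>Oddness cancels the contributions of \<open>g\<close> and \<open>h\<close> to their
  commutator up to \<open>3 * D\<close>, and each multiplication costs another \<open>D\<close>. So
  products of \<open>k\<close> commutators have values at most \<open>4 * D * k\<close>, while
  \<open>\<phi>\<close> is unbounded.\<close>

lemma quasimorphism_commutator_width:
  fixes G (structure) and \<phi> :: "'a \<Rightarrow> int"
  assumes "group G" and perfect: "derived G (carrier G) = carrier G"
    and quasi: "\<And>g h. g \<in> carrier G \<Longrightarrow> h \<in> carrier G \<Longrightarrow> \<bar>\<phi> (g \<otimes>\<^bsub>G\<^esub> h) - \<phi> g - \<phi> h\<bar> \<le> D"
    and odd: "\<And>g. g \<in> carrier G \<Longrightarrow> \<phi> (inv\<^bsub>G\<^esub> g) = - \<phi> g"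
    and unbounded: "\<And>n. \<exists>g\<in>carrier G. \<phi> g \<ge> n"
  shows "commutator_width G = \<infinity>"
proof -
  interpret group G by (rule assms(1))
  have comm: "\<phi> c \<le> 3 * D" if c: "c \<in> derived_set G (carrier G)" for c
  proof -
    obtain g h where gh: "g \<in> carrier G" "h \<in> carrier G" "c = g \<otimes> h \<otimes> inv g \<otimes> inv h"
      using c by blast
    have "\<bar>\<phi> c - \<phi> (g \<otimes> h \<otimes> inv g) - \<phi> (inv h)\<bar> \<le> D"
      "\<bar>\<phi> (g \<otimes> h \<otimes> inv g) - \<phi> (g \<otimes> h) - \<phi> (inv g)\<bar> \<le> D"
      "\<bar>\<phi> (g \<otimes> h) - \<phi> g - \<phi> h\<bar> \<le> D"
      unfolding gh(3) by (intro quasi m_closed inv_closed gh(1,2))+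
    then show ?thesis using odd[OF gh(1)] odd[OF gh(2)] by linarith
  qed
  have "\<phi> \<one> = 0" using odd[of \<one>] by simp
  have "D \<ge> 0" using quasi[of \<one> \<one>] by simp
  have prod: "list_prod G cs \<in> carrier G \<and> \<phi> (list_prod G cs) \<le> 4 * D * int (length cs)"
    if "set cs \<subseteq> derived_set G (carrier G)" for cs
    using that
  proof (induction cs)
    case Nil
    then show ?case using \<open>\<phi> \<one> = 0\<close> by (simp add: list_prod_def)
  next
    case (Cons c cs)
    have c: "c \<in> carrier G" "c \<in> derived_set G (carrier G)"
      using Cons.prems derived_set_in_carrier[of "carrier G"] by auto
    have cs: "list_prod G cs \<in> carrier G" "\<phi> (list_prod G cs) \<le> 4 * D * int (length cs)"
      using Cons by auto
    have "list_prod G (c # cs) = c \<otimes> list_prod G cs" by (simp add: list_prod_def)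
    moreover have "\<phi> (c \<otimes> list_prod G cs) \<le> 3 * D + D + 4 * D * int (length cs)"
      using quasi[OF c(1) cs(1)] comm[OF c(2)] cs(2) by linarith
    ultimately show ?case using c cs by (simp add: algebra_simps)
  qed
  have "enat n \<le> commutator_width G" for n
  proof -
    obtain g where g: "g \<in> carrier G" "\<phi> g \<ge> 4 * D * int n + 1" using unbounded by blast
    have "enat n \<le> length_wrt G (derived_set G (carrier G)) g"
      unfolding length_wrt_def
    proof (rule INF_greatest)
      fix k assume "k \<in> {k. \<exists>ps. length ps = k \<and> set ps \<subseteq> derived_set G (carrier G) \<and> list_prod G ps = g}"
      then have "4 * D * int n + 1 \<le> 4 * D * int k" using prod g(2) by force
      then have "n \<le> k" using \<open>D \<ge> 0\<close> mult_left_mono[of "int k" "int n" "4 * D"] by force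
      then show "enat n \<le> enat k" by simp
    qed
    also have "\<dots> \<le> commutator_width G"
      unfolding commutator_width_def using g(1) perfect by (intro SUP_upper) simp
    finally show ?thesis .
  qed
  then show ?thesis by (metis enat_ord_simps(4) enat_ord_simps(1) enat.exhaust not_less_eq_eq order_refl)
qed

lemma simple_grp_perfect:
  fixes G (structure)
  assumes "simple_grp G" "x \<in> carrier G" "y \<in> carrier G" "x \<otimes>\<^bsub>G\<^esub> y \<noteq> y \<otimes>\<^bsub>G\<^esub> x"
  shows "derived G (carrier G) = carrier G"
proof -
  interpret group G using assms(1) by (simp add: simple_grp_def)
  have "x \<otimes> y \<otimes> inv x \<otimes> inv y \<in> derived G (carrier G)"
    unfolding derived_def using assms by (intro generate.incl) auto
  moreover have "x \<otimes> y \<otimes> inv x \<otimes> inv y \<noteq> \<one>"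
  proof
    assume "x \<otimes> y \<otimes> inv x \<otimes> inv y = \<one>"
    then have "x \<otimes> y \<otimes> inv (y \<otimes> x) = \<one>" using assms by (simp add: m_assoc inv_mult_group)
    then have "inv (inv (y \<otimes> x)) = x \<otimes> y" using assms by (intro inv_equality) auto
    then show False using assms by simp
  qed
  ultimately show ?thesis
    using derived_self_is_normal assms(1) unfolding simple_grp_def by blast
qed

section \<open>Transport to an isomorphic group on the natural numbers\<close>

lemma simple_grp_iso:
  assumes "simple_grp G" "group H" "h \<in> iso G H"
  shows "simple_grp H"
proof -
  interpret G: group G using assms(1) by (simp add: simple_grp_def)
  interpret H: group H by (rule assms(2))
  have inv: "inv_into (carrier G) h \<in> iso H G" by (rule G.iso_set_sym[OF assms(3)])
  then interpret I: group_hom H G "inv_into (carrier G) h"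
    by unfold_locales (auto simp: iso_def)
  interpret h: group_hom G H h using assms(3) by unfold_locales (auto simp: iso_def)
  have bij: "bij_betw h (carrier G) (carrier H)" using assms(3) by (simp add: iso_def)
  have hinv: "h (inv_into (carrier G) h y) = y" if "y \<in> carrier H" for y
    using that bij bij_betw_inv_into_right by metis
  have "N = {\<one>\<^bsub>H\<^esub>} \<or> N = carrier H" if "N \<lhd> H" for N
  proof -
    have NH: "N \<subseteq> carrier H" using that by (meson normal_imp_subgroup subgroup.subset)
    have N: "h ` inv_into (carrier G) h ` N = N"
      using NH hinv by (simp add: image_image subset_iff)
    have "inv_into (carrier G) h ` N \<lhd> G"
      using normal.surj_hom_normal_subgroup[OF that I.group_hom_axioms] inv
      by (simp add: iso_def bij_betw_def)
    then have "inv_into (carrier G) h ` N = {\<one>\<^bsub>G\<^esub>} \<or> inv_into (carrier G) h ` N = carrier G"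
      using assms(1) by (simp add: simple_grp_def)
    then show ?thesis using N bij by (auto simp: bij_betw_def)
  qed
  moreover have "carrier H \<noteq> {\<one>\<^bsub>H\<^esub>}"
  proof
    assume "carrier H = {\<one>\<^bsub>H\<^esub>}"
    then have "carrier G = {inv_into (carrier G) h \<one>\<^bsub>H\<^esub>}"
      using inv by (auto simp: iso_def bij_betw_def)
    then show False using assms(1) by (simp add: simple_grp_def)
  qed
  ultimately show ?thesis using H.group_axioms by (simp add: simple_grp_def)
qed

lemma finitely_generated_iso:
  assumes "group G" "finitely_generated G" "group H" "h \<in> iso G H"
  shows "finitely_generated H"
proof -
  interpret h: group_hom G H h using assms unfolding group_hom_def group_hom_axioms_def
    by (auto simp: iso_def)
  obtain X where X: "finite X" "X \<subseteq> carrier G" "generate G X = carrier G"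
    using assms(2) by (auto simp: finitely_generated_def generating_set_def)
  have "generate H (h ` X) = h ` generate G X" using h.generate_img[OF X(2)] by simp
  also have "\<dots> = carrier H" using assms(4) X(3) by (simp add: iso_def bij_betw_def)
  finally show ?thesis
    unfolding finitely_generated_def generating_set_def using X by (intro exI[of _ "h ` X"]) auto
qed

text \<open>Brings the group of tree automorphisms, whose elements are functions, to the type
  \<open>nat\<close>.\<close>

lemma countable_group_iso_nat:
  fixes G (structure)
  assumes "group G" "countable (carrier G)"
  obtains H :: "nat monoid" and h where "group H" "h \<in> iso G H"
proof -
  interpret group G by (rule assms(1))
  define h where "h = to_nat_on (carrier G)"
  have inj: "inj_on h (carrier G)" using assms(2) by (simp add: h_def inj_on_to_nat_on)
  define k where "k = inv_into (carrier G) h"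
  have k: "k (h x) = x" if "x \<in> carrier G" for x using that inj by (simp add: k_def)
  define H :: "nat monoid" where
    "H = \<lparr>carrier = h ` carrier G, monoid.mult = (\<lambda>a b. h (k a \<otimes> k b)), one = h \<one>\<rparr>"
  have "h \<in> hom G H" by (auto simp: hom_def H_def k)
  moreover have "bij_betw h (carrier G) (carrier H)" using inj by (simp add: H_def bij_betw_def)
  ultimately have iso: "h \<in> iso G H" by (simp add: iso_def)
  have "group H"
  proof (rule groupI)
    fix x assume "x \<in> carrier H"
    then obtain a where "a \<in> carrier G" "x = h a" by (auto simp: H_def)
    then show "\<exists>y\<in>carrier H. y \<otimes>\<^bsub>H\<^esub> x = \<one>\<^bsub>H\<^esub>"
      by (intro bexI[of _ "h (inv a)"]) (auto simp: H_def k)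
  qed (auto simp: H_def k m_assoc)
  then show ?thesis using iso that by blast
qed

subsection \<open>A group of tree automorphisms\<close>

text \<open>The symmetric group of a whole type; tree automorphisms are therefore extended by the
  identity outside \<open>edges\<close>.\<close>

definition bij_group :: "('c \<Rightarrow> 'c) monoid" where
  "bij_group = \<lparr>carrier = {f. bij f}, monoid.mult = (\<circ>), one = id\<rparr>"

lemma bij_group_simps [simp]:
  "carrier bij_group = {f. bij f}" "f \<otimes>\<^bsub>bij_group\<^esub> g = f \<circ> g" "\<one>\<^bsub>bij_group\<^esub> = id"
  by (simp_all add: bij_group_def)

lemma group_bij_group: "group bij_group"
proof (rule groupI)
  fix f :: "'a \<Rightarrow> 'a" assume "f \<in> carrier bij_group"
  then show "\<exists>g\<in>carrier bij_group. g \<otimes>\<^bsub>bij_group\<^esub> f = \<one>\<^bsub>bij_group\<^esub>"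
    by (intro bexI[of _ "inv_into UNIV f"]) (auto simp: bij_imp_bij_inv inv_o_cancel bij_is_inj)
qed (auto simp: comp_assoc bij_comp)

context group
begin

text \<open>Here \<open>G\<close> acts on itself by left and right multiplication. The edges of a tree with vertices of
  degree \<open>|G|\<close> are encoded by their paths from a base vertex: \<open>x # w\<close> leaves the base vertex
  along the edge \<open>x\<close> and makes at the vertices that follow the turns \<open>w\<close>, where the turn from edge
  \<open>x\<close> to edge \<open>y\<close> at a vertex is \<open>inv x \<otimes> y\<close>. The base edge is \<open>[\<one>]\<close>.\<close>

definition tails :: "'a list set" where
  "tails = {w. set w \<subseteq> carrier G - {\<one>}}"

definition edges :: "'a list set" where
  "edges = {x # w | x w. x \<in> carrier G \<and> w \<in> tails}"

lemma tails_simps [simp]: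
  "[] \<in> tails" "x # w \<in> tails \<longleftrightarrow> x \<in> carrier G \<and> x \<noteq> \<one> \<and> w \<in> tails"
  "v @ w \<in> tails \<longleftrightarrow> v \<in> tails \<and> w \<in> tails"
  by (auto simp: tails_def)

lemma edges_simps [simp]:
  "[] \<notin> edges" "x # w \<in> edges \<longleftrightarrow> x \<in> carrier G \<and> w \<in> tails"
  by (auto simp: edges_def)

lemma edgesE:
  assumes "e \<in> edges"
  obtains x w where "e = x # w" "x \<in> carrier G" "w \<in> tails"
  using assms by (auto simp: edges_def)

lemma edges_append [simp]: "e \<in> edges \<Longrightarrow> e @ w \<in> edges \<longleftrightarrow> w \<in> tails"
  by (auto elim!: edgesE)

text \<open>Rotation about the base vertex. At all other vertices labels are translated from the
  left, which preserves turns, so only the head changes.\<close>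

definition rot :: "'a \<Rightarrow> 'a \<Rightarrow> 'a list \<Rightarrow> 'a list" where
  "rot g h e = (if e \<in> edges then (g \<otimes> hd e \<otimes> inv h) # tl e else e)"

text \<open>The inversion of the base edge: it rewrites paths from one end of \<open>[\<one>]\<close> as paths from the other
  end.\<close>

definition flip :: "'a list \<Rightarrow> 'a list" where
  "flip e = (if e \<notin> edges then e else if hd e \<noteq> \<one> then \<one> # e
     else if tl e = [] then e else tl e)"

lemma rot_Cons: "x \<in> carrier G \<Longrightarrow> w \<in> tails \<Longrightarrow> rot g h (x # w) = (g \<otimes> x \<otimes> inv h) # w"
  by (simp add: rot_def)

lemma rot_in_edges: "g \<in> carrier G \<Longrightarrow> h \<in> carrier G \<Longrightarrow> e \<in> edges \<Longrightarrow> rot g h e \<in> edges"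
  by (auto simp: rot_def elim!: edgesE)

lemma flip_Cons:
  assumes "x \<in> carrier G" "w \<in> tails"
  shows "x \<noteq> \<one> \<Longrightarrow> flip (x # w) = \<one> # x # w"
    and "w \<noteq> [] \<Longrightarrow> flip (\<one> # w) = w"
  using assms by (auto simp: flip_def)

lemma flip_base [simp]: "flip [\<one>] = [\<one>]"
  by (simp add: flip_def)

lemma flip_in_edges: "e \<in> edges \<Longrightarrow> flip e \<in> edges"
  by (cases "tl e") (auto simp: flip_def elim!: edgesE)

lemma flip_flip [simp]: "flip (flip e) = e"
proof (cases "e \<in> edges")
  case True
  then obtain x w where e: "e = x # w" "x \<in> carrier G" "w \<in> tails" by (rule edgesE)
  then show ?thesis by (cases w; cases "x = \<one>") (auto simp: flip_Cons)
qed (simp add: flip_def)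

lemma rot_rot:
  assumes "g \<in> carrier G" "h \<in> carrier G" "g' \<in> carrier G" "h' \<in> carrier G"
  shows "rot g h (rot g' h' e) = rot (g \<otimes> g') (h \<otimes> h') e"
proof (cases "e \<in> edges")
  case True
  then obtain x w where "e = x # w" "x \<in> carrier G" "w \<in> tails" by (rule edgesE)
  then show ?thesis using assms by (simp add: rot_Cons m_assoc inv_mult_group)
qed (simp add: rot_def)

lemma rot_one [simp]: "rot \<one> \<one> = id"
  by (auto simp: rot_def fun_eq_iff elim!: edgesE)

text \<open>The Boolean selects the end of the base edge about which to rotate.\<close>

definition side :: "bool \<Rightarrow> 'a \<Rightarrow> 'a \<Rightarrow> 'a list \<Rightarrow> 'a list" where
  "side b g h = (if b then flip \<circ> rot g h \<circ> flip else rot g h)"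

lemma side_comp:
  assumes "g \<in> carrier G" "h \<in> carrier G" "g' \<in> carrier G" "h' \<in> carrier G"
  shows "side b g h \<circ> side b g' h' = side b (g \<otimes> g') (h \<otimes> h')"
  using rot_rot[OF assms] by (auto simp: side_def fun_eq_iff)

lemma side_one [simp]: "side b \<one> \<one> = id"
  by (auto simp: side_def fun_eq_iff)

lemma bij_side:
  assumes "g \<in> carrier G" "h \<in> carrier G"
  shows "bij (side b g h)"
  using side_comp[of g h "inv g" "inv h" b] side_comp[of "inv g" "inv h" g h b] assms
  by (intro o_bij[of "side b (inv g) (inv h)"]) auto

lemma side_in_edges:
  assumes "g \<in> carrier G" "h \<in> carrier G" "e \<in> edges"
  shows "side b g h e \<in> edges"
  using assms by (auto simp: side_def intro: rot_in_edges flip_in_edges)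

lemma side_outside: "e \<notin> edges \<Longrightarrow> side b g h e = e"
  by (auto simp: side_def rot_def flip_def)

definition sides :: "('a list \<Rightarrow> 'a list) set" where
  "sides = {side b g h | b g h. g \<in> carrier G \<and> h \<in> carrier G}"

definition tree_group :: "('a list \<Rightarrow> 'a list) monoid" where
  "tree_group = bij_group\<lparr>carrier := generate bij_group sides\<rparr>"

lemma sides_bij: "sides \<subseteq> carrier bij_group"
  using bij_side by (auto simp: sides_def)

lemma group_tree_group: "group tree_group"
  unfolding tree_group_def
  using group.subgroup_imp_group[OF group_bij_group] group.generate_is_subgroup[OF group_bij_group sides_bij]
  by blast

lemma tree_group_simps [simp]:
  "f \<otimes>\<^bsub>tree_group\<^esub> g = f \<circ> g" "\<one>\<^bsub>tree_group\<^esub> = id"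
  by (simp_all add: tree_group_def)

lemma side_in_tree_group [simp]:
  assumes "g \<in> carrier G" "h \<in> carrier G"
  shows "side b g h \<in> carrier tree_group"
  using assms by (auto simp: tree_group_def sides_def intro!: generate.incl)

lemma tree_group_bij: "f \<in> carrier tree_group \<Longrightarrow> bij f"
  using group.generate_in_carrier[OF group_bij_group sides_bij] by (auto simp: tree_group_def)

lemma tree_group_generated: "generating_set tree_group sides"
  using group.generate_consistent[OF group_bij_group subset_refl]
    group.generate_consistent[OF group_bij_group _ group.generate_is_subgroup[OF group_bij_group sides_bij],
      of sides]
  by (auto simp: generating_set_def tree_group_def intro: generate.incl)

text \<open>The inverse of a generator is again a generator, so it is enough to compose with one
  generator at a time.\<close>

lemma tree_group_induct [consumes 1, case_names id side]:
  assumes "f \<in> carrier tree_group" "P id"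
    and step: "\<And>b g h f. g \<in> carrier G \<Longrightarrow> h \<in> carrier G \<Longrightarrow> P f \<Longrightarrow> P (side b g h \<circ> f)"
  shows "P f"
proof -
  have "f \<in> generate bij_group sides" using assms(1) by (simp add: tree_group_def)
  \<comment> \<open>The extra factor \<open>k\<close> reduces the case of a product to
    associativity.\<close>
  then have "P (f \<circ> k)" if "P k" for k
    using that
  proof (induction arbitrary: k)
    case (inv h)
    then obtain b x y where h: "h = side b x y" "x \<in> carrier G" "y \<in> carrier G"
      by (auto simp: sides_def)
    have eq: "inv\<^bsub>bij_group\<^esub> h = side b (inv x) (inv y)"
      using h bij_side side_comp[of "inv x" "inv y" x y b]
      by (intro group.inv_equality[OF group_bij_group]) auto
    show ?case unfolding eq using h inv.prems by (intro step inv_closed)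
  next
    case (eng h1 h2)
    then show ?case by (simp add: comp_assoc)
  qed (use step in \<open>auto simp: sides_def\<close>)
  from this[OF \<open>P id\<close>] show ?thesis by simp
qed

lemma tree_group_edges:
  assumes "f \<in> carrier tree_group"
  shows "e \<in> edges \<Longrightarrow> f e \<in> edges" "e \<notin> edges \<Longrightarrow> f e = e"
  using assms by (induction f rule: tree_group_induct) (auto simp: side_in_edges side_outside)

text \<open>The sum of \<open>\<kappa>\<close> over the turns of the path from one edge to another. After the common prefix, the
  first path is traversed backwards, which inverts its turns.\<close>

fun turns :: "('a \<Rightarrow> int) \<Rightarrow> 'a list \<Rightarrow> 'a list \<Rightarrow> int" where
  "turns \<kappa> [] f = sum_list (map \<kappa> f)"
| "turns \<kappa> (x # u) [] = sum_list (map (\<lambda>y. \<kappa> (inv y)) (x # u))"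
| "turns \<kappa> (x # u) (y # w) = (if x = y then turns \<kappa> u w
     else sum_list (map (\<lambda>y. \<kappa> (inv y)) u) + \<kappa> (inv x \<otimes> y) + sum_list (map \<kappa> w))"

lemma turns_Nil2: "turns \<kappa> u [] = sum_list (map (\<lambda>y. \<kappa> (inv y)) u)"
  by (cases u) auto

section \<open>Invariance of turn sums under the group\<close>

definition class_fun :: "('a \<Rightarrow> int) \<Rightarrow> bool" where
  "class_fun \<kappa> \<longleftrightarrow> \<kappa> \<one> = 0 \<and> (\<forall>x\<in>carrier G. \<forall>g\<in>carrier G. \<kappa> (g \<otimes> x \<otimes> inv g) = \<kappa> x)"

text \<open>A rotation replaces the turn \<open>inv x \<otimes> y\<close> at the base vertex by its
  conjugate under \<open>h\<close> and keeps all other turns.\<close>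

lemma turns_rot:
  assumes "class_fun \<kappa>" "g \<in> carrier G" "h \<in> carrier G" "e \<in> edges" "f \<in> edges"
  shows "turns \<kappa> (rot g h e) (rot g h f) = turns \<kappa> e f"
proof -
  obtain x u where e: "e = x # u" "x \<in> carrier G" "u \<in> tails" using assms(4) by (rule edgesE)
  obtain y w where f: "f = y # w" "y \<in> carrier G" "w \<in> tails" using assms(5) by (rule edgesE)
  have "g \<otimes> x \<otimes> inv h = g \<otimes> y \<otimes> inv h \<longleftrightarrow> x = y" using assms e f by simp
  moreover have "inv (g \<otimes> x \<otimes> inv h) \<otimes> (g \<otimes> y \<otimes> inv h) = h \<otimes> (inv x \<otimes> y) \<otimes> inv h"
  proof -
    have "inv (g \<otimes> x \<otimes> inv h) \<otimes> (g \<otimes> y \<otimes> inv h)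
        = h \<otimes> (inv x \<otimes> (inv g \<otimes> (g \<otimes> (y \<otimes> inv h))))"
      using assms e f by (simp add: inv_mult_group m_assoc)
    also have "inv g \<otimes> (g \<otimes> (y \<otimes> inv h)) = y \<otimes> inv h"
      using assms f by (simp add: m_assoc[symmetric])
    finally show ?thesis using assms e f by (simp add: m_assoc)
  qed
  ultimately show ?thesis
    using assms e f by (simp add: rot_Cons class_fun_def)
qed

text \<open>The path between two edges does not depend on the end of the base edge from which they
  are encoded. The cases record on which side of the base edge each of them lies and whether it is
  the base edge.\<close>

lemma turns_flip:
  assumes "class_fun \<kappa>" "e \<in> edges" "f \<in> edges"
  shows "turns \<kappa> (flip e) (flip f) = turns \<kappa> e f"
proof -
  have one: "\<kappa> \<one> = 0" using assms(1) by (simp add: class_fun_def)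
  obtain x u where e: "e = x # u" "x \<in> carrier G" "u \<in> tails" using assms(2) by (rule edgesE)
  obtain y w where f: "f = y # w" "y \<in> carrier G" "w \<in> tails" using assms(3) by (rule edgesE)
  show ?thesis
    using e f one by (cases "x = \<one>"; cases "y = \<one>"; cases u; cases w) (auto simp: flip_Cons)
qed

lemma turns_side:
  assumes "class_fun \<kappa>" "g \<in> carrier G" "h \<in> carrier G" "e \<in> edges" "f \<in> edges"
  shows "turns \<kappa> (side b g h e) (side b g h f) = turns \<kappa> e f"
  using assms by (auto simp: side_def turns_rot turns_flip rot_in_edges flip_in_edges)

lemma turns_tree_group:
  assumes "class_fun \<kappa>" "f \<in> carrier tree_group" "d \<in> edges" "e \<in> edges"
  shows "turns \<kappa> (f d) (f e) = turns \<kappa> d e"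
proof -
  have "f d \<in> edges \<and> f e \<in> edges \<and> turns \<kappa> (f d) (f e) = turns \<kappa> d e"
    using assms(2) by (induction rule: tree_group_induct) (use assms in \<open>auto simp: turns_side side_in_edges\<close>)
  then show ?thesis by simp
qed

end

subsection \<open>The turn-counting quasimorphism\<close>

context group
begin

definition odd_fun :: "('a \<Rightarrow> int) \<Rightarrow> bool" where
  "odd_fun \<kappa> \<longleftrightarrow> (\<forall>x\<in>carrier G. \<kappa> (inv x) = - \<kappa> x \<and> \<bar>\<kappa> x\<bar> \<le> 1)"

lemma sum_list_odd:
  assumes "odd_fun \<kappa>" "set u \<subseteq> carrier G"
  shows "sum_list (map (\<lambda>y. \<kappa> (inv y)) u) = - sum_list (map \<kappa> u)"
  using assms(2) by (induction u) (use assms(1) in \<open>auto simp: odd_fun_def\<close>)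

lemma odd_swap:
  assumes "odd_fun \<kappa>" "x \<in> carrier G" "y \<in> carrier G"
  shows "\<kappa> (inv y \<otimes> x) = - \<kappa> (inv x \<otimes> y)"
proof -
  have "inv y \<otimes> x = inv (inv x \<otimes> y)" using assms by (simp add: inv_mult_group)
  then show ?thesis using assms by (simp add: odd_fun_def)
qed

lemma odd_bound:
  assumes "odd_fun \<kappa>" "x \<in> carrier G"
  shows "\<bar>\<kappa> x\<bar> \<le> 1"
  using assms by (simp add: odd_fun_def)

text \<open>Traversing a path backwards inverts each of its turns.\<close>

lemma turns_swap:
  assumes "odd_fun \<kappa>" "set e \<subseteq> carrier G" "set f \<subseteq> carrier G"
  shows "turns \<kappa> f e = - turns \<kappa> e f"
  using assms(2,3)
proof (induction e arbitrary: f)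
  case Nil
  then show ?case using sum_list_odd[OF assms(1)] by (simp add: turns_Nil2)
next
  case (Cons x u)
  show ?case
  proof (cases f)
    case Nil
    then show ?thesis using sum_list_odd[OF assms(1)] Cons.prems assms(1) by (simp add: odd_fun_def)
  next
    case (Cons y w)
    then show ?thesis
      using Cons.IH[of w] Cons.prems assms(1) by (auto simp: sum_list_odd odd_swap[of _ x y])
  qed
qed

text \<open>Where the lists separate, the single turn \<open>inv x \<otimes> y\<close> replaces the
  entries \<open>x\<close> and \<open>y\<close>; these three terms are the whole error.\<close>

lemma turns_relative:
  assumes "odd_fun \<kappa>" "set e \<subseteq> carrier G" "set f \<subseteq> carrier G"
  shows "\<bar>turns \<kappa> e f + sum_list (map \<kappa> e) - sum_list (map \<kappa> f)\<bar> \<le> 3"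
  using assms(2,3)
proof (induction e arbitrary: f)
  case Nil
  then show ?case by simp
next
  case (Cons x u)
  show ?case
  proof (cases f)
    case Nil
    then show ?thesis using Cons.prems assms(1) by (simp add: sum_list_odd odd_fun_def)
  next
    case (Cons y w)
    show ?thesis
    proof (cases "x = y")
      case True
      then show ?thesis using Cons.IH[of w] Cons.prems Cons by simp
    next
      case False
      have "\<bar>\<kappa> x\<bar> \<le> 1" "\<bar>\<kappa> y\<bar> \<le> 1" "\<bar>\<kappa> (inv x \<otimes> y)\<bar> \<le> 1"
        using Cons.prems Cons by (auto intro!: odd_bound[OF assms(1)])
      then show ?thesis using False Cons.prems Cons assms(1) by (simp add: sum_list_odd)
    qed
  qed
qed

text \<open>Three edges span a tripod, and the turns along its legs cancel except for those at the
  centre.\<close>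

lemma turns_triangle:
  assumes "odd_fun \<kappa>" "set d \<subseteq> carrier G" "set e \<subseteq> carrier G" "set f \<subseteq> carrier G"
  shows "\<bar>turns \<kappa> d e + turns \<kappa> e f + turns \<kappa> f d\<bar> \<le> 3"
  using assms(2-4)
proof (induction d arbitrary: e f)
  case Nil
  then show ?case
    using turns_relative[OF assms(1), of e f] by (simp add: turns_Nil2 sum_list_odd[OF assms(1)])
next
  case (Cons x u)
  note prems = Cons.prems
  note odd = sum_list_odd[OF assms(1)]
  consider "e = []" | "f = []" | y v z w where "e = y # v" "f = z # w"
    by (cases e; cases f) auto
  then show ?case
  proof cases
    case 1
    then show ?thesis
      using turns_relative[OF assms(1), of f "x # u"] prems by (simp add: turns_Nil2 odd del: turns.simps(3))
        (use assms(1) in \<open>simp add: odd_fun_def\<close>)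
  next
    case 2
    then show ?thesis
      using turns_relative[OF assms(1), of "x # u" e] prems by (simp add: turns_Nil2 odd del: turns.simps(3))
  next
    case (3 y v z w)
    have xyz: "x \<in> carrier G" "y \<in> carrier G" "z \<in> carrier G"
      and sub: "set u \<subseteq> carrier G" "set v \<subseteq> carrier G" "set w \<subseteq> carrier G"
      using 3 prems by auto
    have bound: "\<bar>\<kappa> (inv x \<otimes> y)\<bar> \<le> 1" "\<bar>\<kappa> (inv y \<otimes> z)\<bar> \<le> 1" "\<bar>\<kappa> (inv z \<otimes> x)\<bar> \<le> 1"
      using xyz by (auto intro!: odd_bound[OF assms(1)])
    have swap: "\<kappa> (inv y \<otimes> x) = - \<kappa> (inv x \<otimes> y)" "\<kappa> (inv z \<otimes> y) = - \<kappa> (inv y \<otimes> z)"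
      "\<kappa> (inv x \<otimes> z) = - \<kappa> (inv z \<otimes> x)"
      using xyz by (auto intro!: odd_swap[OF assms(1)])
    note rel = turns_relative[OF assms(1) sub(1,2)] turns_relative[OF assms(1) sub(2,3)]
      turns_relative[OF assms(1) sub(3,1)]
    \<comment> \<open>The cases say which edges leave the vertex together. If exactly two do, the
      leg to the third cancels and \<open>turns_relative\<close> bounds the rest; if none do, this
      vertex is the centre and its three turns remain.\<close>
    consider (all) "x = y" "y = z" | (xy) "x = y" "y \<noteq> z" | (yz) "y = z" "z \<noteq> x"
      | (zx) "z = x" "x \<noteq> y" | (none) "x \<noteq> y" "y \<noteq> z" "z \<noteq> x" by blast
    then show ?thesis
    proof cases
      case all
      then show ?thesis using Cons.IH[OF sub] 3 by simp
    next
      case xy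
      then show ?thesis using rel(1) swap 3 sub by (simp add: odd)
    next
      case yz
      then show ?thesis using rel(2) swap 3 sub by (simp add: odd)
    next
      case zx
      then show ?thesis using rel(3) swap 3 sub by (simp add: odd)
    next
      case none
      then have "turns \<kappa> (x # u) e + turns \<kappa> e f + turns \<kappa> f (x # u)
          = \<kappa> (inv x \<otimes> y) + \<kappa> (inv y \<otimes> z) + \<kappa> (inv z \<otimes> x)"
        using 3 sub by (simp add: odd)
      then show ?thesis using bound by linarith
    qed
  qed
qed

lemma edges_subset: "e \<in> edges \<Longrightarrow> set e \<subseteq> carrier G"
  by (auto simp: edges_def tails_def)

lemma base_edge [simp]: "[\<one>] \<in> edges"
  by simp

text \<open>Invariance identifies the sum from \<open>f [\<one>]\<close> to
  \<open>f (h [\<one>])\<close> with the value at \<open>h\<close>, so the defect is the sum around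
  the triangle with corners \<open>[\<one>]\<close>, \<open>f [\<one>]\<close> and
  \<open>f (h [\<one>])\<close>.\<close>

lemma tree_group_quasimorphism:
  assumes \<kappa>: "class_fun \<kappa>" "odd_fun \<kappa>" and f: "f \<in> carrier tree_group" and h: "h \<in> carrier tree_group"
  shows "\<bar>turns \<kappa> [\<one>] ((f \<otimes>\<^bsub>tree_group\<^esub> h) [\<one>]) - turns \<kappa> [\<one>] (f [\<one>]) - turns \<kappa> [\<one>] (h [\<one>])\<bar> \<le> 3"
proof -
  have E: "f [\<one>] \<in> edges" "h [\<one>] \<in> edges" "f (h [\<one>]) \<in> edges"
    using tree_group_edges f h by auto
  have "\<bar>turns \<kappa> [\<one>] (f [\<one>]) + turns \<kappa> (f [\<one>]) (f (h [\<one>])) + turns \<kappa> (f (h [\<one>])) [\<one>]\<bar> \<le> 3"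
    using E by (intro turns_triangle[OF \<kappa>(2)] edges_subset) auto
  moreover have "turns \<kappa> (f [\<one>]) (f (h [\<one>])) = turns \<kappa> [\<one>] (h [\<one>])"
    using E by (intro turns_tree_group[OF \<kappa>(1) f]) auto
  moreover have "turns \<kappa> (f (h [\<one>])) [\<one>] = - turns \<kappa> [\<one>] (f (h [\<one>]))"
    using E by (intro turns_swap[OF \<kappa>(2)] edges_subset) auto
  ultimately show ?thesis by simp
qed

text \<open>Applying \<open>f\<close> moves the path from the base edge to its preimage onto the
  path from \<open>f [\<one>]\<close> back to the base edge.\<close>

lemma tree_group_quasimorphism_inv:
  assumes \<kappa>: "class_fun \<kappa>" "odd_fun \<kappa>" and f: "f \<in> carrier tree_group"
  shows "turns \<kappa> [\<one>] ((inv\<^bsub>tree_group\<^esub> f) [\<one>]) = - turns \<kappa> [\<one>] (f [\<one>])"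
proof -
  interpret T: group tree_group by (rule group_tree_group)
  let ?h = "inv\<^bsub>tree_group\<^esub> f"
  have h: "?h \<in> carrier tree_group" using f by simp
  have "f (?h [\<one>]) = [\<one>]" using T.r_inv[OF f] by (simp add: fun_eq_iff)
  then have "turns \<kappa> [\<one>] (?h [\<one>]) = turns \<kappa> (f [\<one>]) [\<one>]"
    using turns_tree_group[OF \<kappa>(1) f base_edge, of "?h [\<one>]"] tree_group_edges(1)[OF h base_edge]
    by simp
  then show ?thesis
    using turns_swap[OF \<kappa>(2), of "[\<one>]" "f [\<one>]"] edges_subset tree_group_edges(1)[OF f base_edge]
    by simp
qed

text \<open>The translation \<open>side True z \<one> \<circ> side False z \<one>\<close> is hyperbolic and makes the turn \<open>z\<close> at every
  vertex of its axis.\<close>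

lemma tree_group_quasimorphism_unbounded:
  assumes z: "z \<in> carrier G" "z \<noteq> \<one>" "\<kappa> \<one> = 0" "\<kappa> z = 1"
  shows "\<exists>f\<in>carrier tree_group. turns \<kappa> [\<one>] (f [\<one>]) \<ge> n"
proof -
  interpret T: group tree_group by (rule group_tree_group)
  define t where "t = side True z \<one> \<circ> side False z \<one>"
  have t: "t \<in> carrier tree_group" unfolding t_def using T.m_closed[of "side True z \<one>" "side False z \<one>"] z by simp
  have rep: "replicate k z \<in> tails" for k using z by (induction k) auto
  \<comment> \<open>Each of the two rotations contributes one turn \<open>z\<close>, so the orbit of
    the base edge under \<open>t\<close> consists of the lists below.\<close>
  have step: "t (\<one> # w) = \<one> # z # z # w" if "w \<in> tails" for w
    using that z by (simp add: t_def side_def rot_Cons flip_Cons)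
  have "\<exists>f\<in>carrier tree_group. f [\<one>] = \<one> # replicate (2 * k) z" for k
  proof (induction k)
    case 0
    show ?case using T.one_closed by (intro bexI[of _ id]) auto
  next
    case (Suc k)
    then obtain f where "f \<in> carrier tree_group" "f [\<one>] = \<one> # replicate (2 * k) z" by blast
    then show ?case using T.m_closed[OF t] step[OF rep] by (intro bexI[of _ "t \<circ> f"]) auto
  qed
  from this[of "nat n"] obtain f where
    f: "f \<in> carrier tree_group" "f [\<one>] = \<one> # replicate (2 * nat n) z" by blast
  have "turns \<kappa> [\<one>] (f [\<one>]) = int (2 * nat n)"
    using f z by (simp add: sum_list_replicate)
  then show ?thesis using f by (intro bexI[of _ f]) auto
qed

end

subsection \<open>Simplicity\<close>

lemma comp_commute_disjoint_support:
  assumes "bij f" "bij g" and f: "\<And>x. x \<notin> A \<Longrightarrow> f x = x" and g: "\<And>x. x \<notin> B \<Longrightarrow> g x = x"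
    and "A \<inter> B = {}"
  shows "f \<circ> g = g \<circ> f"
proof
  fix x
  have inj: "inj f" "inj g" using assms(1,2) by (auto simp: bij_is_inj)
  consider "x \<in> A" | "x \<in> B" | "x \<notin> A" "x \<notin> B" by blast
  then show "(f \<circ> g) x = (g \<circ> f) x"
  proof cases
    case 1
    \<comment> \<open>If \<open>f x\<close> lay outside \<open>A\<close>, it would be fixed by
      \<open>f\<close>, and injectivity would give \<open>f x = x\<close>.\<close>
    have "f x \<in> A" using 1 f[of "f x"] injD[OF inj(1), of "f x" x] by metis
    then have "x \<notin> B" "f x \<notin> B" using 1 assms(5) by blast+
    then show ?thesis by (simp add: g)
  next
    case 2
    have "g x \<in> B" using 2 g[of "g x"] injD[OF inj(2), of "g x" x] by metis
    then have "x \<notin> A" "g x \<notin> A" using 2 assms(5) by blast+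
    then show ?thesis by (simp add: f)
  qed (use f g in auto)
qed

context group
begin

text \<open>Modulo \<open>N\<close>, the element \<open>a\<close> equals its conjugate by \<open>n\<close>, which commutes with \<open>b\<close>.\<close>

lemma commutator_in_normal:
  assumes N: "N \<lhd> G" and n: "n \<in> N" and a: "a \<in> carrier G" and b: "b \<in> carrier G"
    and comm: "(n \<otimes> a \<otimes> inv n) \<otimes> b = b \<otimes> (n \<otimes> a \<otimes> inv n)"
  shows "a \<otimes> b \<otimes> inv a \<otimes> inv b \<in> N"
proof -
  interpret N: normal N G by fact
  have nc: "n \<in> carrier G" using n N.subset by blast
  define c where "c = n \<otimes> a \<otimes> inv n"
  have c: "c \<in> carrier G" using nc a by (simp add: c_def)
  \<comment> \<open>This is the commutator of \<open>a\<close> and \<open>n\<close>, hence in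
    \<open>N\<close>. As \<open>c\<close> commutes with \<open>b\<close>, the commutator of
    \<open>d\<close> and \<open>b\<close> equals that of \<open>a\<close> and
    \<open>b\<close>.\<close>
  define d where "d = a \<otimes> inv c"
  have "d = (a \<otimes> n \<otimes> inv a) \<otimes> inv n"
    using nc a by (simp add: d_def c_def inv_mult_group m_assoc)
  then have d: "d \<in> N" using N.inv_op_closed2[OF a n] n by simp
  have dc: "d \<in> carrier G" using d N.subset by blast
  have "b \<otimes> inv d \<otimes> inv b \<in> N" using N.inv_op_closed2[OF b] d by simp
  then have "d \<otimes> (b \<otimes> inv d \<otimes> inv b) \<in> N" using d by simp
  moreover have "d \<otimes> (b \<otimes> inv d \<otimes> inv b) = a \<otimes> b \<otimes> inv a \<otimes> inv b"
  proof -
    have "inv c \<otimes> b \<otimes> c = b"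
      using comm c b unfolding c_def[symmetric] by (metis inv_solve_left m_assoc m_closed inv_closed)
    then have "a \<otimes> (inv c \<otimes> b \<otimes> c) \<otimes> inv a \<otimes> inv b = a \<otimes> b \<otimes> inv a \<otimes> inv b" by simp
    then show ?thesis using a b c by (simp add: d_def inv_mult_group m_assoc)
  qed
  ultimately show ?thesis by simp
qed

text \<open>A perfect group is generated by its commutators, so only their images need
  checking.\<close>

lemma hom_from_perfect_in_normal:
  assumes perfect: "derived G (carrier G) = carrier G"
    and N: "subgroup N H" and H: "group H"
    and \<theta>: "\<And>g h. g \<in> carrier G \<Longrightarrow> h \<in> carrier G \<Longrightarrow> \<theta> (g \<otimes> h) = \<theta> g \<otimes>\<^bsub>H\<^esub> \<theta> h"
    and closed: "\<And>g. g \<in> carrier G \<Longrightarrow> \<theta> g \<in> carrier H"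
    and comm: "\<And>g h. g \<in> carrier G \<Longrightarrow> h \<in> carrier G \<Longrightarrow> \<theta> (g \<otimes> h \<otimes> inv g \<otimes> inv h) \<in> N"
    and g: "g \<in> carrier G"
  shows "\<theta> g \<in> N"
proof -
  interpret H: group H by (rule H)
  interpret \<theta>: group_hom G H \<theta> using \<theta> closed by unfold_locales (auto simp: hom_def)
  have "g \<in> generate G (derived_set G (carrier G))" using g perfect by (simp add: derived_def)
  then show ?thesis
  proof induction
    case one
    then show ?case using N by (simp add: subgroup.one_closed)
  next
    case (incl h)
    then show ?case using comm by auto
  next
    case (inv h)
    then have "h \<in> carrier G" "\<theta> h \<in> N" using comm by auto
    then show ?case using subgroup.m_inv_closed[OF N] by simp
  next
    case (eng h1 h2)
    have "h1 \<in> carrier G" "h2 \<in> carrier G"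
      using eng.hyps generate_in_carrier[OF derived_set_in_carrier] by auto
    then show ?case using eng.IH subgroup.m_closed[OF N] by simp
  qed
qed

text \<open>Perfectness enters twice: first for the diagonal elements \<open>\<psi> x x\<close>,
  then for \<open>\<psi> \<one> x\<close>, because the commutator of \<open>\<psi> \<one> g\<close>
  with the diagonal element \<open>\<psi> h h\<close> is \<open>\<psi> \<one>\<close> at the
  commutator of \<open>g\<close> and \<open>h\<close>.\<close>

lemma two_sided_action_in_normal:
  assumes perfect: "derived G (carrier G) = carrier G"
    and N: "N \<lhd> H"
    and \<psi>: "\<And>g h g' h'. \<lbrakk>g \<in> carrier G; h \<in> carrier G; g' \<in> carrier G; h' \<in> carrier G\<rbrakk>
      \<Longrightarrow> \<psi> g h \<otimes>\<^bsub>H\<^esub> \<psi> g' h' = \<psi> (g \<otimes> g') (h \<otimes> h')"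
    and closed: "\<And>g h. g \<in> carrier G \<Longrightarrow> h \<in> carrier G \<Longrightarrow> \<psi> g h \<in> carrier H"
    and one: "\<psi> \<one> \<one> = \<one>\<^bsub>H\<^esub>"
    and comm: "\<And>g h. \<lbrakk>g \<in> carrier G; h \<in> carrier G\<rbrakk>
      \<Longrightarrow> \<psi> (g \<otimes> h \<otimes> inv g \<otimes> inv h) (g \<otimes> h \<otimes> inv g \<otimes> inv h) \<in> N"
    and gh: "g \<in> carrier G" "h \<in> carrier G"
  shows "\<psi> g h \<in> N"
proof -
  interpret N: normal N H by (rule N)
  have sub: "subgroup N H" by (rule N.subgroup_axioms)
  have inv: "inv\<^bsub>H\<^esub> (\<psi> x y) = \<psi> (inv x) (inv y)" if "x \<in> carrier G" "y \<in> carrier G" for x y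
    using that \<psi>[of "inv x" "inv y" x y] closed one by (intro N.inv_equality) auto
  have diag: "\<psi> x x \<in> N" if "x \<in> carrier G" for x
    using hom_from_perfect_in_normal[OF perfect sub N.group_axioms, of "\<lambda>x. \<psi> x x" x] \<psi> closed comm that
    by simp
  have right: "\<psi> \<one> x \<in> N" if "x \<in> carrier G" for x
  proof (rule hom_from_perfect_in_normal[OF perfect sub N.group_axioms, of "\<lambda>x. \<psi> \<one> x"])
    fix g h assume gh: "g \<in> carrier G" "h \<in> carrier G"
    have "\<psi> \<one> g \<otimes>\<^bsub>H\<^esub> \<psi> h h \<otimes>\<^bsub>H\<^esub> inv\<^bsub>H\<^esub> (\<psi> \<one> g) \<in> N"
      using N.inv_op_closed2 closed diag gh by simp
    then have "\<psi> \<one> g \<otimes>\<^bsub>H\<^esub> \<psi> h h \<otimes>\<^bsub>H\<^esub> inv\<^bsub>H\<^esub> (\<psi> \<one> g) \<otimes>\<^bsub>H\<^esub> \<psi> (inv h) (inv h) \<in> N"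
      using diag gh by simp
    then show "\<psi> \<one> (g \<otimes> h \<otimes> inv g \<otimes> inv h) \<in> N"
      using gh by (simp add: inv \<psi>)
  qed (use \<psi> closed that in auto)
  have "\<psi> g g \<otimes>\<^bsub>H\<^esub> \<psi> \<one> (inv g \<otimes> h) \<in> N" using diag right gh by simp
  then show ?thesis using gh by (simp add: \<psi> m_assoc[symmetric])
qed

section \<open>Tree distance and the action far from the base edge\<close>

lemma turns_append_same: "turns \<kappa> e (e @ w) = sum_list (map \<kappa> w)"
  by (induction e) auto

text \<open>If \<open>f\<close> does not lie beyond \<open>e\<close>, the path from \<open>f\<close>
  to \<open>e @ w\<close> passes through \<open>e\<close>.\<close>

lemma turns_append:
  assumes "\<nexists>v. f = e @ v"
  shows "turns \<kappa> f (e @ w) = turns \<kappa> f e + sum_list (map \<kappa> w)"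
  using assms
proof (induction e arbitrary: f)
  case (Cons y e)
  then show ?case by (cases f) auto
qed auto

text \<open>With this weight, \<open>turns\<close> between edges is their distance in the
  tree.\<close>

definition unit_turn :: "'a \<Rightarrow> int" where
  "unit_turn x = (if x = \<one> then 0 else 1)"

lemma class_fun_unit_turn: "class_fun unit_turn"
  unfolding class_fun_def
proof (intro conjI ballI)
  fix x g assume xg: "x \<in> carrier G" "g \<in> carrier G"
  have "g \<otimes> x \<otimes> inv g = \<one> \<longleftrightarrow> x = \<one>"
    using xg by (simp add: inv_solve_right')
  then show "unit_turn (g \<otimes> x \<otimes> inv g) = unit_turn x" by (simp add: unit_turn_def)
qed (simp add: unit_turn_def)

lemma sum_list_unit_turn: "w \<in> tails \<Longrightarrow> sum_list (map unit_turn w) = int (length w)"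
  by (induction w) (auto simp: unit_turn_def)

lemma turns_unit_turn_eq_0:
  assumes "e \<in> edges" "f \<in> edges" "turns unit_turn e f = 0"
  shows "e = f"
proof -
  have nonneg: "0 \<le> sum_list (map unit_turn w)" "0 \<le> sum_list (map (\<lambda>y. unit_turn (inv y)) w)" for w
    by (auto intro!: sum_list_nonneg simp: unit_turn_def)
  have unit: "unit_turn (inv x \<otimes> y) = 1" if "x \<in> carrier G" "y \<in> carrier G" "x \<noteq> y" for x y
  proof -
    have "inv x \<otimes> y \<noteq> \<one>" using that inv_equality[of "inv x" y] inv_inv by (metis inv_closed)
    then show ?thesis by (simp add: unit_turn_def)
  qed
  have tails: "u = w" if "u \<in> tails" "w \<in> tails" "turns unit_turn u w = 0" for u w
    using that
  proof (induction u arbitrary: w)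
    case Nil
    then show ?case using sum_list_unit_turn[of w] by simp
  next
    case (Cons x u)
    show ?case
    proof (cases w)
      case Nil
      have "unit_turn (inv x) = 1" using Cons.prems unit[of x \<one>] by simp
      then show ?thesis using Cons.prems nonneg(2)[of u] Nil by simp
    next
      case w: (Cons y v)
      then show ?thesis
        using Cons unit[of x y] nonneg(1)[of v] nonneg(2)[of u] by (cases "x = y") auto
    qed
  qed
  obtain x u where e: "e = x # u" "x \<in> carrier G" "u \<in> tails" using assms(1) by (rule edgesE)
  obtain y w where f: "f = y # w" "y \<in> carrier G" "w \<in> tails" using assms(2) by (rule edgesE)
  show ?thesis
    using e f assms(3) tails[of u w] unit[of x y] nonneg(1)[of w] nonneg(2)[of u]
    by (cases "x = y") auto
qed

text \<open>Far from the base edge, the elements of the group act by replacing prefixes. The bound on the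
  lengths makes this property stable under composition.\<close>

definition eventually_prefixed :: "('a list \<Rightarrow> 'a list) \<Rightarrow> bool" where
  "eventually_prefixed f \<longleftrightarrow> (\<exists>m. \<forall>e\<in>edges. length e \<le> length (f e) + m \<and>
     (m \<le> length e \<longrightarrow> (\<forall>w\<in>tails. f (e @ w) = f e @ w)))"

lemma eventually_prefixed_comp:
  assumes "eventually_prefixed f" "eventually_prefixed g" "\<And>e. e \<in> edges \<Longrightarrow> g e \<in> edges"
  shows "eventually_prefixed (f \<circ> g)"
proof -
  obtain m where m: "\<And>e. e \<in> edges \<Longrightarrow> length e \<le> length (f e) + m"
    "\<And>e w. \<lbrakk>e \<in> edges; w \<in> tails; m \<le> length e\<rbrakk> \<Longrightarrow> f (e @ w) = f e @ w"
    using assms(1) unfolding eventually_prefixed_def by blast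
  obtain k where k: "\<And>e. e \<in> edges \<Longrightarrow> length e \<le> length (g e) + k"
    "\<And>e w. \<lbrakk>e \<in> edges; w \<in> tails; k \<le> length e\<rbrakk> \<Longrightarrow> g (e @ w) = g e @ w"
    using assms(2) unfolding eventually_prefixed_def by blast
  show ?thesis
    unfolding eventually_prefixed_def
  \<comment> \<open>Applying \<open>g\<close> shortens a path by at most \<open>k\<close>, which
    leaves the length \<open>m\<close> required by \<open>f\<close>.\<close>
  proof (intro exI[of _ "m + k"] ballI conjI impI)
    fix e assume e: "e \<in> edges"
    show "length e \<le> length ((f \<circ> g) e) + (m + k)"
      using k(1)[OF e] m(1)[OF assms(3)[OF e]] by simp
    fix w assume w: "w \<in> tails" and len: "m + k \<le> length e"
    have "m \<le> length (g e)" using k(1)[OF e] len by linarith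
    then show "(f \<circ> g) (e @ w) = (f \<circ> g) e @ w"
      using k(2)[OF e w] m(2)[OF assms(3)[OF e] w] len by simp
  qed
qed

lemma eventually_prefixed_rot: "eventually_prefixed (rot g h)"
  unfolding eventually_prefixed_def
  by (rule exI[of _ 0]) (auto simp: rot_Cons elim!: edgesE)

lemma eventually_prefixed_flip: "eventually_prefixed flip"
  unfolding eventually_prefixed_def
\<comment> \<open>Length 1 is too short: \<open>flip\<close> fixes \<open>[\<one>]\<close> but
  removes the \<open>\<one>\<close> from its proper extensions.\<close>
proof (intro exI[of _ 2] ballI conjI impI)
  fix e assume "e \<in> edges"
  then obtain x u where e: "e = x # u" "x \<in> carrier G" "u \<in> tails" by (rule edgesE)
  show "length e \<le> length (flip e) + 2"
    using e by (cases "x = \<one>"; cases u) (auto simp: flip_Cons)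
  fix w assume "w \<in> tails" "2 \<le> length e"
  then show "flip (e @ w) = flip e @ w"
    using e by (cases "x = \<one>"; cases u) (auto simp: flip_Cons)
qed

lemma eventually_prefixed_tree_group:
  assumes "f \<in> carrier tree_group"
  shows "eventually_prefixed f"
proof -
  have "(\<forall>e\<in>edges. f e \<in> edges) \<and> eventually_prefixed f"
    using assms
  proof (induction rule: tree_group_induct)
    case id
    show ?case by (auto simp: eventually_prefixed_def)
  next
    case (side b g h f)
    have "eventually_prefixed (side b g h)"
      using side(1,2) by (auto simp: side_def intro!: eventually_prefixed_comp eventually_prefixed_rot
        eventually_prefixed_flip rot_in_edges flip_in_edges)
    then have "eventually_prefixed (side b g h \<circ> f)"
      using side by (intro eventually_prefixed_comp) auto
    moreover have "\<forall>e\<in>edges. (side b g h \<circ> f) e \<in> edges"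
      using side by (simp add: side_in_edges)
    ultimately show ?case by blast
  qed
  then show ?thesis by simp
qed

text \<open>The conclusion makes \<open>p\<close> and \<open>f p\<close> incomparable as prefixes,
  so the cone beyond \<open>p\<close> is carried to a disjoint cone. Such a \<open>p\<close> is
  found deep in the tree, where \<open>f\<close> replaces prefixes.\<close>

lemma tree_group_moves_cone:
  assumes f: "f \<in> carrier tree_group" "f \<noteq> id"
    and ab: "a \<in> carrier G - {\<one>}" "b \<in> carrier G - {\<one>}" "a \<noteq> b"
  shows "\<exists>p\<in>edges. (\<forall>w\<in>tails. f (p @ w) = f p @ w) \<and> (\<forall>v w. p @ v \<noteq> f p @ w)"
proof -
  obtain m where m: "\<And>e w. \<lbrakk>e \<in> edges; w \<in> tails; m \<le> length e\<rbrakk> \<Longrightarrow> f (e @ w) = f e @ w"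
    using eventually_prefixed_tree_group[OF f(1)] unfolding eventually_prefixed_def by blast
  obtain e where "f e \<noteq> e" using f(2) by (auto simp: fun_eq_iff)
  then have e: "e \<in> edges" using tree_group_edges(2)[OF f(1)] by blast
  then have fe: "f e \<in> edges" using tree_group_edges(1)[OF f(1)] by blast
  define l where "l = replicate m a"
  have l: "l \<in> tails" "length l = m" using ab(1) by (auto simp: l_def tails_def)
  \<comment> \<open>If \<open>f\<close> fixed all deep edges beyond \<open>e\<close>, then
    \<open>e\<close> and \<open>f e\<close> would be equally far from each of them. This is
    impossible if \<open>f e\<close> lies properly beyond \<open>e\<close>, and otherwise puts
    \<open>f e\<close> at distance 0 from \<open>e\<close>.\<close>
  have "\<exists>r\<in>tails. m \<le> length r \<and> f (e @ r) \<noteq> e @ r"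
  proof (rule ccontr)
    assume "\<not> ?thesis"
    then have fixed: "f (e @ r) = e @ r" if "r \<in> tails" "m \<le> length r" for r using that by blast
    have dist: "turns unit_turn (f e) (e @ r) = int (length r)" if r: "r \<in> tails" "m \<le> length r" for r
    proof -
      have "turns unit_turn (f e) (f (e @ r)) = turns unit_turn e (e @ r)"
        using e r by (intro turns_tree_group[OF class_fun_unit_turn f(1)]) auto
      then show ?thesis using fixed[OF r] r by (simp add: turns_append_same sum_list_unit_turn)
    qed
    show False
    proof (cases "\<exists>v. f e = e @ v")
      case True
      then obtain v where v: "f e = e @ v" by blast
      then have "v \<in> tails" using fe e by simp
      then have "turns unit_turn (f e) (e @ v @ l) = int (length v + length l)"
        using l dist[of "v @ l"] by simp
      moreover have "turns unit_turn (f e) (e @ v @ l) = int (length l)"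
        using turns_append_same[of unit_turn "e @ v" l] v l by (simp add: sum_list_unit_turn)
      ultimately show False using v \<open>f e \<noteq> e\<close> by simp
    next
      case False
      then have "turns unit_turn (f e) e = 0"
        using turns_append[of "f e" e unit_turn l] dist[of l] l by (simp add: sum_list_unit_turn)
      then show False using turns_unit_turn_eq_0[OF fe e] \<open>f e \<noteq> e\<close> by simp
    qed
  qed
  then obtain r where r: "r \<in> tails" "m \<le> length r" "f (e @ r) \<noteq> e @ r" by blast
  define p where "p = e @ r"
  have p: "p \<in> edges" "m \<le> length p" "f p \<noteq> p" using e r by (auto simp: p_def)
  have pre: "f (p @ u @ w) = f (p @ u) @ w" if "u \<in> tails" "w \<in> tails" for u w
    using m[of p "u @ w"] m[of p u] p that by simp
  have sep: ?thesis if x: "x \<in> carrier G - {\<one>}" and ne: "\<And>v w. p @ x # v \<noteq> f p @ x # w" for x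
  proof (intro bexI[of _ "p @ [x]"] conjI ballI allI)
    show "p @ [x] \<in> edges" using p x by simp
    show "f ((p @ [x]) @ w) = f (p @ [x]) @ w" if "w \<in> tails" for w
      using pre[of "[x]" w] x that by simp
    show "(p @ [x]) @ v \<noteq> f (p @ [x]) @ w" for v w
      using ne[of v w] m[of p "[x]"] p x by simp
  qed
  have choice: "\<exists>x\<in>carrier G - {\<one>}. x \<noteq> y" for y using ab by metis
  \<comment> \<open>If one of \<open>p\<close> and \<open>f p\<close> extends the other by
    \<open>y\<close>, appending a different letter \<open>x\<close> to both makes them incomparable;
    \<open>a\<close> and \<open>b\<close> ensure that such an \<open>x\<close> exists.\<close>
  consider (longer) y v where "f p = p @ y # v" | (shorter) y v where "p = f p @ y # v"
    | (incomparable) "\<And>v w. p @ v \<noteq> f p @ w"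
    using p(3) by (metis append_eq_append_conv2 append_Nil2 list.exhaust)
  then show ?thesis
  proof cases
    case longer
    obtain x where x: "x \<in> carrier G - {\<one>}" "x \<noteq> y" using choice by blast
    then show ?thesis by (intro sep[of x]) (auto simp: longer)
  next
    case shorter
    obtain x where x: "x \<in> carrier G - {\<one>}" "x \<noteq> y" using choice by blast
    have "p @ x # v' \<noteq> f p @ x # w" for v' w
      using x shorter by (metis append_assoc append_Cons list.inject same_append_eq)
    then show ?thesis using sep[OF x(1)] by blast
  next
    case incomparable
    then show ?thesis using p m by blast
  qed
qed

text \<open>The two half-trees at the base edge are \<open>\<one> # w\<close> and
  \<open>flip (\<one> # w)\<close>. The generators fix an end of this edge and so preserve the
  bipartition of the vertices; hence the parity of \<open>length p\<close> decides which half-tree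
  is carried to the cone beyond \<open>p\<close>.\<close>

lemma tree_group_cone:
  assumes "p \<in> edges"
  shows "\<exists>f\<in>carrier tree_group. \<forall>w\<in>tails. f (if even (length p) then flip (\<one> # w) else \<one> # w) = p @ w"
  using assms
proof (induction p rule: rev_induct)
  case (snoc x p)
  interpret T: group tree_group by (rule group_tree_group)
  show ?case
  proof (cases "p = []")
    case True
    then have "x \<in> carrier G" using snoc.prems by simp
    then have "\<forall>w\<in>tails. side False x \<one> (\<one> # w) = [x] @ w"
      by (simp add: side_def rot_Cons)
    then show ?thesis using True \<open>x \<in> carrier G\<close> by (intro bexI[of _ "side False x \<one>"]) auto
  next
    case False
    then obtain y u where p: "p = y # u" by (cases p) auto
    then have pe: "p \<in> edges" and x: "x \<in> carrier G" "x \<noteq> \<one>" using snoc.prems by auto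
    obtain f where f: "f \<in> carrier tree_group"
      "\<And>w. w \<in> tails \<Longrightarrow> f (if even (length p) then flip (\<one> # w) else \<one> # w) = p @ w"
      using snoc.IH[OF pe] by blast
    \<comment> \<open>Moves the opposite half-tree into the one treated by \<open>f\<close>, at the
      place that \<open>f\<close> sends to \<open>p @ x # w\<close>.\<close>
    define k where "k = side (odd (length p)) x \<one>"
    have "f \<circ> k \<in> carrier tree_group" using T.m_closed[OF f(1), of k] x by (simp add: k_def)
    moreover have "(f \<circ> k) (if even (length (p @ [x])) then flip (\<one> # w) else \<one> # w) = (p @ [x]) @ w"
      if "w \<in> tails" for w
      using f(2)[of "x # w"] x that by (auto simp: k_def side_def rot_Cons flip_Cons split: if_splits)
    ultimately show ?thesis by blast
  qed
qed simp

text \<open>With equal parameters the rotation fixes the base edge. Since it keeps turns, it also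
  fixes the half-tree seen across this edge from its centre.\<close>

lemma side_support:
  assumes "g \<in> carrier G" "e \<notin> (\<lambda>w. if b then \<one> # w else flip (\<one> # w)) ` tails"
  shows "side b g g e = e"
proof (cases "e \<in> edges")
  case True
  have rot: "rot g g (\<one> # w) = \<one> # w" if "w \<in> tails" for w using that assms(1) by (simp add: rot_Cons)
  obtain x w where e: "e = x # w" "x \<in> carrier G" "w \<in> tails" using True by (rule edgesE)
  show ?thesis
  proof (cases b)
    case True
    then have "x \<noteq> \<one>" using assms(2) e by auto
    then show ?thesis using True e rot[of "x # w"] by (simp add: side_def flip_Cons)
  next
    case False
    have "x = \<one>"
    proof (rule ccontr)
      assume "x \<noteq> \<one>"
      then have "e = flip (\<one> # e)" "e \<in> tails" using e by (simp_all add: flip_Cons)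
      then show False using assms(2) False by auto
    qed
    then show ?thesis using False e rot by (simp add: side_def)
  qed
qed (rule side_outside)

text \<open>An element of \<open>N\<close> moves a cone off itself, so \<open>N\<close> contains all commutators of elements
  supported in this cone, and hence those of the conjugate stabilisers of the base edge.\<close>

lemma side_commutator_in_normal:
  assumes N: "N \<lhd> tree_group" "N \<noteq> {id}"
    and ab: "a \<in> carrier G - {\<one>}" "b \<in> carrier G - {\<one>}" "a \<noteq> b"
    and gh: "g \<in> carrier G" "h \<in> carrier G"
  shows "side c (g \<otimes> h \<otimes> inv g \<otimes> inv h) (g \<otimes> h \<otimes> inv g \<otimes> inv h) \<in> N"
proof -
  interpret N: normal N tree_group by (rule N(1))
  have Tinv: "f ((inv\<^bsub>tree_group\<^esub> f) e) = e" "(inv\<^bsub>tree_group\<^esub> f) (f e) = e"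
    if "f \<in> carrier tree_group" for f e
    using N.r_inv[OF that] N.l_inv[OF that] by (simp_all add: fun_eq_iff)
  have "id \<in> N" using subgroup.one_closed[OF N.subgroup_axioms] by simp
  then obtain n where n: "n \<in> N" "n \<noteq> id" using N(2) by blast
  then have nc: "n \<in> carrier tree_group" using N.subset by blast
  obtain p0 where p0: "p0 \<in> edges" "\<And>w. w \<in> tails \<Longrightarrow> n (p0 @ w) = n p0 @ w"
    "\<And>v w. p0 @ v \<noteq> n p0 @ w"
    using tree_group_moves_cone[OF nc n(2) ab] by blast
  \<comment> \<open>A further letter \<open>a\<close> corrects the parity, so that the half-tree
    supporting \<open>side c x x\<close> can be moved to the cone beyond \<open>p\<close>.\<close>
  define p where "p = (if c = odd (length p0) then p0 else p0 @ [a])"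
  have p: "p \<in> edges" "c = odd (length p)" using p0(1) ab(1) by (auto simp: p_def)
  define C where "C = (\<lambda>w. p @ w) ` tails"
  have disj: "n ` C \<inter> C = {}"
    using p0 ab(1) by (auto simp: C_def p_def dest!: sym[of "n _"] split: if_splits)
  obtain t where t: "t \<in> carrier tree_group"
    "\<And>w. w \<in> tails \<Longrightarrow> t (if even (length p) then flip (\<one> # w) else \<one> # w) = p @ w"
    using tree_group_cone[OF p(1)] by blast
  let ?i = "\<lambda>f. inv\<^bsub>tree_group\<^esub> f"
  \<comment> \<open>The stabiliser elements \<open>side c x x\<close>, moved by \<open>t\<close> so
    that they are supported in \<open>C\<close>.\<close>
  define u where "u x = t \<otimes>\<^bsub>tree_group\<^esub> side c x x \<otimes>\<^bsub>tree_group\<^esub> ?i t" for x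
  have u: "u x \<in> carrier tree_group" if "x \<in> carrier G" for x
    unfolding u_def using that t(1) by (intro N.m_closed N.inv_closed) auto
  have supp: "u x e = e" if x: "x \<in> carrier G" and e: "e \<notin> C" for x e
  proof -
    have "?i t e \<notin> (\<lambda>w. if c then \<one> # w else flip (\<one> # w)) ` tails"
    proof
      assume "?i t e \<in> (\<lambda>w. if c then \<one> # w else flip (\<one> # w)) ` tails"
      then obtain w where w: "w \<in> tails" "?i t e = (if c then \<one> # w else flip (\<one> # w))" by blast
      then have "t (?i t e) = p @ w" using t(2)[OF w(1)] p(2) by (auto split: if_splits)
      then show False using e w(1) Tinv(1)[OF t(1)] by (auto simp: C_def)
    qed
    then show ?thesis using side_support[OF x] Tinv(1)[OF t(1)] by (simp add: u_def)
  qed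
  have "u g \<otimes>\<^bsub>tree_group\<^esub> u h \<otimes>\<^bsub>tree_group\<^esub> ?i (u g) \<otimes>\<^bsub>tree_group\<^esub> ?i (u h) \<in> N"
  proof (rule N.commutator_in_normal[OF N(1) n(1) u[OF gh(1)] u[OF gh(2)]])
    have "n \<circ> u g \<circ> ?i n \<in> carrier tree_group"
      using N.m_closed[OF N.m_closed[OF nc u[OF gh(1)]] N.inv_closed[OF nc]] by simp
    moreover have "(n \<circ> u g \<circ> ?i n) e = e" if "e \<notin> n ` C" for e
    proof -
      have "?i n e \<notin> C" using that Tinv(1)[OF nc, of e] by force
      then show ?thesis using supp[OF gh(1)] Tinv(1)[OF nc] by simp
    qed
    ultimately have "(n \<circ> u g \<circ> ?i n) \<circ> u h = u h \<circ> (n \<circ> u g \<circ> ?i n)"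
      using u[OF gh(2)] supp[OF gh(2)] disj
      by (intro comp_commute_disjoint_support[of _ _ "n ` C" C] tree_group_bij)
    then show "n \<otimes>\<^bsub>tree_group\<^esub> u g \<otimes>\<^bsub>tree_group\<^esub> ?i n \<otimes>\<^bsub>tree_group\<^esub> u h =
        u h \<otimes>\<^bsub>tree_group\<^esub> (n \<otimes>\<^bsub>tree_group\<^esub> u g \<otimes>\<^bsub>tree_group\<^esub> ?i n)" by simp
  qed
  then have conj: "?i t \<otimes>\<^bsub>tree_group\<^esub> (u g \<otimes>\<^bsub>tree_group\<^esub> u h \<otimes>\<^bsub>tree_group\<^esub> ?i (u g) \<otimes>\<^bsub>tree_group\<^esub> ?i (u h))
      \<otimes>\<^bsub>tree_group\<^esub> t \<in> N"
    by (rule N.inv_op_closed1[OF t(1)])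
  have iu: "?i (u x) = u (inv x)" if "x \<in> carrier G" for x
  proof (rule N.inv_equality)
    show "u (inv x) \<otimes>\<^bsub>tree_group\<^esub> u x = \<one>\<^bsub>tree_group\<^esub>"
      using that side_comp[of "inv x" "inv x" x x c] Tinv[OF t(1)] by (simp add: u_def fun_eq_iff)
  qed (use u that in auto)
  have "?i t \<circ> (u g \<circ> u h \<circ> u (inv g) \<circ> u (inv h)) \<circ> t
      = side c g g \<circ> side c h h \<circ> side c (inv g) (inv g) \<circ> side c (inv h) (inv h)"
    using Tinv[OF t(1)] by (simp add: u_def fun_eq_iff)
  also have "\<dots> = side c (g \<otimes> h \<otimes> inv g \<otimes> inv h) (g \<otimes> h \<otimes> inv g \<otimes> inv h)"
    using gh by (simp add: side_comp)
  finally show ?thesis using conj gh by (simp add: iu)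
qed

lemma tree_group_simple:
  assumes perfect: "derived G (carrier G) = carrier G"
    and ab: "a \<in> carrier G - {\<one>}" "b \<in> carrier G - {\<one>}" "a \<noteq> b"
  shows "simple_grp tree_group"
proof -
  interpret T: group tree_group by (rule group_tree_group)
  have "N = carrier tree_group" if N: "N \<lhd> tree_group" "N \<noteq> {id}" for N
  proof -
    have "sides \<subseteq> N"
    proof
      fix f assume "f \<in> sides"
      then obtain c g h where f: "f = side c g h" "g \<in> carrier G" "h \<in> carrier G"
        by (auto simp: sides_def)
      show "f \<in> N"
        unfolding f(1)
        by (rule two_sided_action_in_normal[OF perfect N(1)])
          (use f side_commutator_in_normal[OF N ab] in \<open>auto simp: side_comp\<close>)
    qed
    then have "generate tree_group sides \<subseteq> N"
      using T.generate_subgroup_incl normal_imp_subgroup[OF N(1)] by blast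
    then have "carrier tree_group \<subseteq> N" using tree_group_generated by (simp add: generating_set_def)
    then show ?thesis using subgroup.subset[OF normal_imp_subgroup[OF N(1)]] by blast
  qed
  moreover have "carrier tree_group \<noteq> {id}"
  proof
    assume "carrier tree_group = {id}"
    then have "side False a \<one> = id" using side_in_tree_group[of a \<one> False] ab by auto
    then have "side False a \<one> [\<one>] = [\<one>]" by simp
    then show False using ab by (simp add: side_def rot_Cons)
  qed
  ultimately show ?thesis using T.group_axioms by (auto simp: simple_grp_def)
qed

end

subsection \<open>Elements not conjugate to their inverses\<close>

text \<open>If \<open>p\<close> inverts \<open>z\<close>, so does its product with any power of
  \<open>z\<close>. One of these products fixes 7 and must be the reflection of
  \<open>{1..6}\<close>, which consists of three transpositions and is odd, although
  \<open>p\<close> and \<open>z\<close> are even.\<close>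

lemma alt_group_7_not_real:
  fixes z :: "nat \<Rightarrow> nat"
  defines "z \<equiv> cycle_of_list [1,2,3,4,5,6,7]"
  shows "z \<in> carrier (alt_group 7)"
    and "\<And>p. p \<in> carrier (alt_group 7) \<Longrightarrow>
      p \<otimes>\<^bsub>alt_group 7\<^esub> z \<otimes>\<^bsub>alt_group 7\<^esub> inv\<^bsub>alt_group 7\<^esub> p \<noteq> inv\<^bsub>alt_group 7\<^esub> z"
proof -
  have z_val: "z 1 = 2" "z 2 = 3" "z 3 = 4" "z 4 = 5" "z 5 = 6" "z 6 = 7" "z 7 = 1"
    by (simp_all add: z_def transpose_def)
  have "z permutes set [1,2,3,4,5,6,7]" unfolding z_def by (rule cycle_permutes)
  moreover have "set [1,2,3,4,5,6,7] = {1..7::nat}" by auto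
  ultimately have perm: "z permutes {1..7}" by simp
  have ev: "evenperm z"
    unfolding z_def by (simp add: evenperm_comp evenperm_swap permutation_compose permutation_swap_id)
  show z: "z \<in> carrier (alt_group 7)" using perm ev by (simp add: alt_group_carrier)
  fix p assume p: "p \<in> carrier (alt_group 7)"
  interpret A: group "alt_group 7" by (rule alt_group_is_group)
  show "p \<otimes>\<^bsub>alt_group 7\<^esub> z \<otimes>\<^bsub>alt_group 7\<^esub> inv\<^bsub>alt_group 7\<^esub> p \<noteq> inv\<^bsub>alt_group 7\<^esub> z"
  proof
    assume eq: "p \<otimes>\<^bsub>alt_group 7\<^esub> z \<otimes>\<^bsub>alt_group 7\<^esub> inv\<^bsub>alt_group 7\<^esub> p = inv\<^bsub>alt_group 7\<^esub> z"
    have "z \<otimes>\<^bsub>alt_group 7\<^esub> (p \<otimes>\<^bsub>alt_group 7\<^esub> z) = p"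
    proof -
      have "p \<otimes>\<^bsub>alt_group 7\<^esub> z = inv\<^bsub>alt_group 7\<^esub> z \<otimes>\<^bsub>alt_group 7\<^esub> p"
        using eq p z by (simp add: A.inv_solve_right')
      then show ?thesis using p z by (simp add: A.m_assoc[symmetric])
    qed
    then have zpz: "z \<circ> (p \<circ> z) = p" by (simp add: alt_group_mult)
    have pp: "p permutes {1..7}" "evenperm p" using p by (auto simp: alt_group_carrier)
    \<comment> \<open>Since \<open>z ^^ j\<close> maps 7 to \<open>j\<close>, the product
      \<open>q\<close> below fixes 7.\<close>
    obtain j where j: "p j = 7" "j \<in> {1..7}"
      using permutes_image[OF pp(1)] by (metis atLeastAtMost_iff image_iff numeral_le_iff one_le_numeral order_refl)
    have pow: "z ^^ k \<in> carrier (alt_group 7)" for k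
    proof (induction k)
      case 0
      then show ?case using A.one_closed by (simp add: alt_group_one id_def)
    next
      case (Suc k)
      then show ?case using A.m_closed[OF z Suc] by (simp add: alt_group_mult comp_def)
    qed
    define q where "q = p \<circ> (z ^^ j)"
    have q: "q \<in> carrier (alt_group 7)"
      unfolding q_def using A.m_closed[OF p pow] by (simp add: alt_group_mult)
    then have qp: "q permutes {1..7}" "evenperm q" by (auto simp: alt_group_carrier)
    have zqz: "z (q (z i)) = q i" for i
      using fun_cong[OF zpz, of "(z ^^ j) i"] by (simp add: q_def funpow_swap1)
    have "(z ^^ Suc k) 7 = Suc k" if "k < 7" for k
      using that
    proof (induction k)
      case 0
      then show ?case using z_val by simp
    next
      case (Suc k)
      have succ: "z m = m + 1" if "m = 1 \<or> m = 2 \<or> m = 3 \<or> m = 4 \<or> m = 5 \<or> m = 6" for m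
        using that z_val by auto
      have "Suc k = 1 \<or> Suc k = 2 \<or> Suc k = 3 \<or> Suc k = 4 \<or> Suc k = 5 \<or> Suc k = 6"
        using Suc.prems by linarith
      then have "z (Suc k) = Suc (Suc k)" using succ[of "Suc k"] by simp
      then show ?case using Suc by simp
    qed
    from this[of "j - 1"] have "(z ^^ j) 7 = j" using j(2) by (cases j) auto
    then have q7: "q 7 = 7" using j by (simp add: q_def)
    have zinj: "z x = z y \<longleftrightarrow> x = y" for x y using permutes_inj[OF perm] by (simp add: inj_eq)
    \<comment> \<open>The relation \<open>zqz\<close> determines each value of \<open>q\<close> from
      the preceding one, starting at 7.\<close>
    have q_val: "q 1 = 6" "q 2 = 5" "q 3 = 4" "q 4 = 3" "q 5 = 2" "q 6 = 1"
    proof -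
      show q1: "q 1 = 6" using zqz[of 7] zinj[of "q 1" 6] z_val q7 by simp
      show q2: "q 2 = 5" using zqz[of 1] zinj[of "q 2" 5] z_val q1 by simp
      show q3: "q 3 = 4" using zqz[of 2] zinj[of "q 3" 4] z_val q2 by simp
      show q4: "q 4 = 3" using zqz[of 3] zinj[of "q 4" 3] z_val q3 by simp
      show q5: "q 5 = 2" using zqz[of 4] zinj[of "q 5" 2] z_val q4 by simp
      show q6: "q 6 = 1" using zqz[of 5] zinj[of "q 6" 1] z_val q5 by simp
    qed
    define t :: "nat \<Rightarrow> nat" where "t = transpose 1 6 \<circ> (transpose 2 5 \<circ> transpose 3 4)"
    have "q = t"
    proof
      fix i
      show "q i = t i"
      proof (cases "i \<in> {1..7}")
        case True
        then have "i = 1 \<or> i = 2 \<or> i = 3 \<or> i = 4 \<or> i = 5 \<or> i = 6 \<or> i = 7" by auto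
        then show ?thesis using q_val q7 by (elim disjE) (simp_all add: t_def transpose_def)
      next
        case False
        then have "q i = i" using permutes_not_in[OF qp(1)] by blast
        moreover have "t i = i" using False by (auto simp: t_def transpose_def)
        ultimately show ?thesis by simp
      qed
    qed
    moreover have "\<not> evenperm t"
      unfolding t_def by (simp add: evenperm_comp evenperm_swap permutation_compose permutation_swap_id)
    ultimately show False using qp(2) by simp
  qed
qed

context group
begin

definition conjugate :: "'a \<Rightarrow> 'a \<Rightarrow> bool" where
  "conjugate x y \<longleftrightarrow> (\<exists>g\<in>carrier G. y = g \<otimes> x \<otimes> inv g)"

lemma conjugate_conj_iff:
  assumes "g \<in> carrier G" "x \<in> carrier G" "y \<in> carrier G"
  shows "conjugate x (g \<otimes> y \<otimes> inv g) \<longleftrightarrow> conjugate x y"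
proof
  assume "conjugate x y"
  then obtain k where "k \<in> carrier G" "y = k \<otimes> x \<otimes> inv k" by (auto simp: conjugate_def)
  then show "conjugate x (g \<otimes> y \<otimes> inv g)"
    unfolding conjugate_def using assms
    by (intro bexI[of _ "g \<otimes> k"]) (simp_all add: inv_mult_group m_assoc)
next
  assume "conjugate x (g \<otimes> y \<otimes> inv g)"
  then obtain k where k: "k \<in> carrier G" "g \<otimes> y \<otimes> inv g = k \<otimes> x \<otimes> inv k"
    by (auto simp: conjugate_def)
  have "y = inv g \<otimes> (g \<otimes> y \<otimes> inv g) \<otimes> g"
    using assms by (simp add: m_assoc) (simp add: m_assoc[symmetric])
  also have "\<dots> = (inv g \<otimes> k) \<otimes> x \<otimes> inv (inv g \<otimes> k)"
    unfolding k(2) using assms k(1) by (simp add: inv_mult_group m_assoc)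
  finally show "conjugate x y" unfolding conjugate_def using assms k(1) by blast
qed

lemma conjugate_inv_iff:
  assumes "x \<in> carrier G" "y \<in> carrier G"
  shows "conjugate (inv x) (inv y) \<longleftrightarrow> conjugate x y"
proof -
  have "inv y = g \<otimes> inv x \<otimes> inv g \<longleftrightarrow> y = g \<otimes> x \<otimes> inv g" if "g \<in> carrier G" for g
  proof -
    have "g \<otimes> inv x \<otimes> inv g = inv (g \<otimes> x \<otimes> inv g)"
      using assms that by (simp add: inv_mult_group m_assoc)
    then show ?thesis using assms that inv_inv by (metis inv_closed m_closed)
  qed
  then show ?thesis by (auto simp: conjugate_def)
qed

text \<open>Take the indicator of the class of \<open>z\<close> minus that of the class of
  \<open>inv z\<close>; these classes are disjoint because \<open>z\<close> is not conjugate to its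
  inverse.\<close>

lemma odd_class_fun_exists:
  assumes z: "z \<in> carrier G" and not_real: "\<not> conjugate z (inv z)"
  shows "\<exists>\<kappa>. class_fun \<kappa> \<and> odd_fun \<kappa> \<and> \<kappa> z = 1 \<and> z \<noteq> \<one>"
proof -
  define \<kappa> :: "'a \<Rightarrow> int" where
    "\<kappa> x = (if conjugate z x then 1 else if conjugate (inv z) x then - 1 else 0)" for x
  have refl: "conjugate x x" if "x \<in> carrier G" for x
    unfolding conjugate_def using that by (intro bexI[of _ \<one>]) auto
  have z1: "z \<noteq> \<one>" using not_real refl[OF one_closed] by auto
  have conj_one: "x = \<one>" if c: "conjugate x \<one>" and x: "x \<in> carrier G" for x
  proof -
    obtain g where "g \<in> carrier G" "\<one> = g \<otimes> x \<otimes> inv g" using c unfolding conjugate_def by blast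
    then show ?thesis using x by (simp add: inv_solve_right)
  qed
  have "\<not> conjugate z \<one>" "\<not> conjugate (inv z) \<one>"
    using conj_one[of z] conj_one[of "inv z"] z z1 by auto
  then have "class_fun \<kappa>"
    using z by (simp add: class_fun_def \<kappa>_def conjugate_conj_iff)
  have not_both: "\<not> conjugate (inv z) x" if "conjugate z x" "x \<in> carrier G" for x
  proof
    assume "conjugate (inv z) x"
    then obtain g where g: "g \<in> carrier G" "x = g \<otimes> inv z \<otimes> inv g" by (auto simp: conjugate_def)
    then show False using that(1) not_real conjugate_conj_iff[of g z "inv z"] z by simp
  qed
  have "odd_fun \<kappa>"
    unfolding odd_fun_def
  proof (intro ballI conjI)
    fix x assume x: "x \<in> carrier G"
    have "conjugate (inv z) (inv x) \<longleftrightarrow> conjugate z x" "conjugate z (inv x) \<longleftrightarrow> conjugate (inv z) x"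
      using conjugate_inv_iff[of z x] conjugate_inv_iff[of "inv z" x] z x by simp_all
    then show "\<kappa> (inv x) = - \<kappa> x" using not_both[OF _ x] by (auto simp: \<kappa>_def)
  qed (simp add: \<kappa>_def)
  then show ?thesis using \<open>class_fun \<kappa>\<close> z1 refl[OF z] by (auto simp: \<kappa>_def)
qed

end

section \<open>Assembling the example from a suitable finite group\<close>

lemma simple_group_from_not_real:
  fixes L (structure)
  assumes "group L" "finite (carrier L)" and perfect: "derived L (carrier L) = carrier L"
    and z: "z \<in> carrier L" and not_real: "\<And>p. p \<in> carrier L \<Longrightarrow> p \<otimes> z \<otimes> inv p \<noteq> inv z"
  shows "\<exists>G :: nat monoid.
           simple_grp G \<and> finitely_generated G \<and> commutator_width G = \<infinity> \<and>
           (\<exists>S. finite S \<and> generating_set G S \<and> palindromic_width G S < \<infinity>)"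
proof -
  interpret L: group L by (rule assms(1))
  let ?T = "L.tree_group"
  interpret T: group ?T by (rule L.group_tree_group)
  have "\<not> L.conjugate z (inv z)" using not_real unfolding L.conjugate_def by metis
  then obtain \<kappa> where \<kappa>: "L.class_fun \<kappa>" "L.odd_fun \<kappa>" "\<kappa> z = 1" and z1: "z \<noteq> \<one>"
    using L.odd_class_fun_exists[OF z] by blast
  \<comment> \<open>Conjugation by \<open>\<one>\<close> already rules out \<open>inv z = z\<close>,
    so \<open>z\<close> and \<open>inv z\<close> are the two nontrivial labels required for
    simplicity.\<close>
  have iz: "inv z \<noteq> z" using not_real[of \<one>] z by auto
  have ab: "z \<in> carrier L - {\<one>}" "inv z \<in> carrier L - {\<one>}" "z \<noteq> inv z"
    using z z1 iz by auto
  have simple: "simple_grp ?T" by (rule L.tree_group_simple[OF perfect ab])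
  have "L.sides = (\<lambda>(b, g, h). L.side b g h) ` (UNIV \<times> carrier L \<times> carrier L)"
    by (auto simp: L.sides_def image_def)
  then have fin: "finite L.sides" using assms(2) by simp
  then have fg: "finitely_generated ?T"
    using L.tree_group_generated by (auto simp: finitely_generated_def)
  have "countable (carrier ?T)"
    using T.countable_generate[of L.sides] L.tree_group_generated fin
    by (auto simp: generating_set_def countable_finite)
  then obtain G :: "nat monoid" and f where G: "group G" "f \<in> iso ?T G"
    by (rule countable_group_iso_nat[OF T.group_axioms])
  interpret G: group G by (rule G(1))
  have simple_G: "simple_grp G" and fg_G: "finitely_generated G"
    using simple_grp_iso[OF simple G] finitely_generated_iso[OF T.group_axioms fg G] by auto
  define k where "k = inv_into (carrier ?T) f"
  have k: "k \<in> iso G ?T" unfolding k_def by (rule T.iso_set_sym[OF G(2)])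
  interpret k: group_hom G ?T k using k by unfold_locales (simp add: iso_def)
  have kbij: "bij_betw k (carrier G) (carrier ?T)" using k by (simp add: iso_def)
  define \<phi> where "\<phi> g = L.turns \<kappa> [\<one>] (k g [\<one>])" for g
  have quasi: "\<bar>\<phi> (g \<otimes>\<^bsub>G\<^esub> h) - \<phi> g - \<phi> h\<bar> \<le> 3" if "g \<in> carrier G" "h \<in> carrier G" for g h
    using L.tree_group_quasimorphism[OF \<kappa>(1,2), of "k g" "k h"] that k.hom_mult[OF that]
    by (simp add: \<phi>_def)
  have odd: "\<phi> (inv\<^bsub>G\<^esub> g) = - \<phi> g" if "g \<in> carrier G" for g
    using L.tree_group_quasimorphism_inv[OF \<kappa>(1,2), of "k g"] that by (simp add: \<phi>_def)
  have unbounded: "\<exists>g\<in>carrier G. \<phi> g \<ge> n" for n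
  proof -
    have "\<kappa> \<one> = 0" using \<kappa>(1) by (simp add: L.class_fun_def)
    from L.tree_group_quasimorphism_unbounded[OF z z1 this \<kappa>(3)]
    obtain t where "t \<in> carrier ?T" "L.turns \<kappa> [\<one>] (t [\<one>]) \<ge> n"
      by blast
    moreover from this obtain g where "g \<in> carrier G" "k g = t"
      using kbij by (metis bij_betw_imp_surj_on imageE)
    ultimately show ?thesis by (auto simp: \<phi>_def)
  qed
  have surj: "\<exists>x\<in>carrier G. k x = t" if "t \<in> carrier ?T" for t
    using bij_betw_imp_surj_on[OF kbij] that by (metis imageE)
  obtain x where x: "x \<in> carrier G" "k x = L.side False z \<one>"
    using surj[OF L.side_in_tree_group[OF z L.one_closed]] by blast
  obtain y where y: "y \<in> carrier G" "k y = L.side True z \<one>"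
    using surj[OF L.side_in_tree_group[OF z L.one_closed]] by blast
  \<comment> \<open>The rotations about the two ends send the base edge to \<open>[z, z]\<close> in
    one order and to \<open>[\<one>, z, z]\<close> in the other.\<close>
  have "(k x \<circ> k y) [\<one>] \<noteq> (k y \<circ> k x) [\<one>]"
    using z z1 by (simp add: x y L.side_def L.rot_Cons L.flip_Cons)
  then have "k x \<circ> k y \<noteq> k y \<circ> k x" by metis
  then have nonab: "x \<otimes>\<^bsub>G\<^esub> y \<noteq> y \<otimes>\<^bsub>G\<^esub> x"
    using k.hom_mult[OF x(1) y(1)] k.hom_mult[OF y(1) x(1)] by auto
  have "commutator_width G = \<infinity>"
    by (rule quasimorphism_commutator_width[OF G(1) simple_grp_perfect[OF simple_G x(1) y(1) nonab] quasi odd unbounded])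
  then show ?thesis
    using simple_G fg_G simple_grp_palindromic_width[OF simple_G fg_G x(1) y(1) nonab] by blast
qed

theorem corollary5:
  shows "\<exists>G :: nat monoid.
           simple_grp G \<and> finitely_generated G \<and> commutator_width G = \<infinity> \<and>
           (\<exists>S. finite S \<and> generating_set G S \<and> palindromic_width G S < \<infinity>)"
proof (rule simple_group_from_not_real)
  show "group (alt_group 7)" by (rule alt_group_is_group)
  show "derived (alt_group 7) (carrier (alt_group 7)) = carrier (alt_group 7)"
    by (rule derived_alt_group_const) simp
  show "finite (carrier (alt_group 7))"
    unfolding alt_group_def by (rule finite_subset[OF _ finite_permutations[of "{1..7}"]]) auto
qed (rule alt_group_7_not_real)+

end
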